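(* For all integers $k \geq 3$ and $r \geq 2$, there exist $c_{k,r} > 0$ and $n_0$ such that, for every integer $n \geq n_0$, there exists a graph $H$ on $n$ vertices satisfying both $H \rightarrow (K_k)_r$ and $\operatorname{girth}\binom{H}{K_k} \geq c_{k,r}\log n$.
   Context: All graphs are finite and simple. $H \rightarrow (K_k)_r$ means that every colouring of the edges of $H$ with $r$ colours yields a monochromatic copy of the complete graph $K_k$. For a graph $H$, $\binom{H}{K_k}$ denotes the $\binom{k}{2}$-uniform hypergraph whose vertex set is the edge set $E(H)$ and whose hyperedges are the edge sets of the copies of $K_k$ in $H$. An $\ell$-uniform hypergraph has girth at least $g$ if, for every integer $h$ with $2 \leq h < g$, any set of $h$ (distinct) hyperedges spans at least $(\ell-1)h+1$ vertices, i.e. their union has at least $(\ell-1)h+1$ elements (here $\ell = \binom{k}{2}$). $\log$ denotes the binary logarithm. *)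

theory Defs
  imports "HOL-Library.Ramsey" Complex_Main
begin

text \<open>Graphs and hypergraphs are pairs of a vertex set and a set of (hyper)edges, the latter being
  sets of vertices. The notation \<open>[V]\<^bsup>m\<^esup>\<close> from the Ramsey theory stands for the set of
  \<open>m\<close>-element subsets of \<open>V\<close>, so \<open>[W]\<^bsup>2\<^esup>\<close> is the edge set of the complete graph on \<open>W\<close>.\<close>

type_synonym 'a hypergraph = "'a set \<times> 'a set set"

abbreviation verts :: "'a hypergraph \<Rightarrow> 'a set"
  where "verts H \<equiv> fst H"

abbreviation edges :: "'a hypergraph \<Rightarrow> 'a set set"
  where "edges H \<equiv> snd H"

definition uniform_hypergraph :: "nat \<Rightarrow> 'a hypergraph \<Rightarrow> bool"
  where "uniform_hypergraph l G \<longleftrightarrow> finite (verts G) \<and> edges G \<subseteq> [verts G]\<^bsup>l\<^esup>"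

abbreviation graph :: "'a hypergraph \<Rightarrow> bool"
  where "graph H \<equiv> uniform_hypergraph 2 H"

definition clique_hypergraph :: "'a hypergraph \<Rightarrow> nat \<Rightarrow> 'a set hypergraph"
  where "clique_hypergraph H k =
    (edges H, {[W]\<^bsup>2\<^esup> | W. W \<in> [verts H]\<^bsup>k\<^esup> \<and> [W]\<^bsup>2\<^esup> \<subseteq> edges H})"

text \<open>\<open>H \<rightarrow> (K\<^sub>k)\<^sub>r\<close>; the hyperedges of \<open>clique_hypergraph H k\<close> are the edge sets of the copies
  of \<open>K\<^sub>k\<close> in \<open>H\<close>.\<close>

definition ramsey_arrow :: "'a hypergraph \<Rightarrow> nat \<Rightarrow> nat \<Rightarrow> bool"
  where "ramsey_arrow H k r \<longleftrightarrow>
    (\<forall>col \<in> edges H \<rightarrow> {..<r}.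
       \<exists>F \<in> edges (clique_hypergraph H k). \<exists>i<r. \<forall>e\<in>F. col e = i)"

text \<open>Girth of an \<open>l\<close>-uniform hypergraph, for \<open>l \<ge> 1\<close>. The bound \<open>g\<close> is real, since it will be a
  multiple of a logarithm; \<open>real h < g\<close> is the same as \<open>h < \<lceil>g\<rceil>\<close>.\<close>

definition girth_at_least :: "nat \<Rightarrow> 'a hypergraph \<Rightarrow> real \<Rightarrow> bool"
  where "girth_at_least l G g \<longleftrightarrow>
    (\<forall>h::nat. 2 \<le> h \<and> real h < g \<longrightarrow>
       (\<forall>S. S \<subseteq> edges G \<and> card S = h \<longrightarrow> card (\<Union>S) \<ge> (l - 1) * h + 1))"

lemma uniform_clique_hypergraph:
  assumes "graph H"
  shows "uniform_hypergraph (k choose 2) (clique_hypergraph H k)"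
proof -
  have "finite (edges H)"
    using assms unfolding uniform_hypergraph_def by (meson finite_imp_finite_nsets finite_subset)
  moreover have "card ([W]\<^bsup>2\<^esup>) = k choose 2" if "W \<in> [verts H]\<^bsup>k\<^esup>" for W
  proof -
    have W: "finite W" "card W = k"
      using that by (auto simp: nsets_def)
    then have "[W]\<^bsup>2\<^esup> = {N. N \<subseteq> W \<and> card N = 2}"
      by (auto simp: nsets_def intro: finite_subset)
    with W show ?thesis
      by (simp add: n_subsets)
  qed
  ultimately show ?thesis
    by (auto simp: uniform_hypergraph_def clique_hypergraph_def nsets_def[of "edges H"]
        intro: finite_subset)
qed

end

theory Submission
  imports Defs
begin

text \<open>Take a random graph on \<open>n\<close> vertices with edge probability \<open>q = M \<tau>\<close>, where \<open>M\<close> is a large constant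
  and \<open>\<tau> = n powr (- 2 / (k + 1))\<close>, so that every edge lies in a bounded number of copies of \<open>K\<^sub>k\<close> on
  average. If few copies of \<open>K\<^sub>k\<close> span fewer edges than the girth condition asks for, then some of
  them form a lasso: a path of cliques glued along single edges, and one more clique that meets the
  path in at least three vertices and adds an edge. The expected number of lassos with \<open>t\<close> cliques
  is at most \<open>C ^ t * n powr (- 1 / (k + 1))\<close> times the number of edges, so for \<open>t\<close> up to a small
  multiple of \<open>log n\<close> all of them can be destroyed by deleting a tiny proportion of the edges.

  The Ramsey property survives such a deletion. The colour classes of a colouring without
  monochromatic \<open>K\<^sub>k\<close> are \<open>K\<^sub>k\<close>-free, hence each lies in a container spanning few copies of \<open>K\<^sub>k\<close>
  that is determined by a fingerprint of \<open>O(\<tau> n\<^sup>2)\<close> edges of the class. By Ramsey's theorem the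
  containers miss a positive proportion of all pairs, and the random graph must avoid nearly all of
  these pairs; this is so unlikely that a union bound over the fingerprints suffices for large \<open>M\<close>.

  The container lemma goes through weights of decreasing uniformity, following the idea of Nenadov
  and Pham: as long as the independent set contains a vertex of large degree, put one into the
  fingerprint and add its link to the weight of lower uniformity; when there is none, the vertices of
  small degree form a container.\<close>

section \<open>Fingerprints and containers\<close>

text \<open>\<open>S I\<close> is the fingerprint of \<open>I\<close> and \<open>F I\<close> its container. Taking \<open>J = S I\<close> in the third condition
  gives \<open>F I = F (S I)\<close>, so there are at most as many containers as fingerprints; the general \<open>J\<close>
  makes the notion closed under composition.\<close>

definition container_maps ::
    "'a set set \<Rightarrow> real \<Rightarrow> ('a set \<Rightarrow> bool) \<Rightarrow> ('a set \<Rightarrow> 'a set) \<Rightarrow> ('a set \<Rightarrow> 'a set) \<Rightarrow> bool"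
  where "container_maps \<I> q P S F \<longleftrightarrow> (\<forall>I.
    S I \<subseteq> I \<and> finite (S I) \<and> real (card (S I)) \<le> q \<and>
    (\<forall>J. S I \<subseteq> J \<longrightarrow> J \<subseteq> I \<longrightarrow> S J = S I \<and> F J = F I) \<and>
    (I \<in> \<I> \<longrightarrow> I \<subseteq> F I \<and> P (F I)))"

definition containers :: "'a set set \<Rightarrow> real \<Rightarrow> ('a set \<Rightarrow> bool) \<Rightarrow> bool"
  where "containers \<I> q P \<longleftrightarrow> (\<exists>S F. container_maps \<I> q P S F)"

lemma container_mapsD:
  assumes "container_maps \<I> q P S F"
  shows "S I \<subseteq> I" "finite (S I)" "real (card (S I)) \<le> q"
    "S I \<subseteq> J \<Longrightarrow> J \<subseteq> I \<Longrightarrow> S J = S I" "S I \<subseteq> J \<Longrightarrow> J \<subseteq> I \<Longrightarrow> F J = F I"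
    "I \<in> \<I> \<Longrightarrow> I \<subseteq> F I" "I \<in> \<I> \<Longrightarrow> P (F I)"
  using assms unfolding container_maps_def by auto

lemma containersE:
  assumes "containers \<I> q P"
  obtains S F where "container_maps \<I> q P S F"
  using assms unfolding containers_def by (elim exE) (rule that)

lemma containersI: "container_maps \<I> q P S F \<Longrightarrow> containers \<I> q P"
  unfolding containers_def by (intro exI)

lemma containers_empty:
  assumes "q \<ge> 0"
  shows "containers {} q P"
  unfolding containers_def container_maps_def
  by (rule exI[of _ "\<lambda>_. {}"], rule exI[of _ "\<lambda>_. {}"]) (use assms in auto)

lemma containers_const:
  assumes "q \<ge> 0" "\<And>I. I \<in> \<I> \<Longrightarrow> I \<subseteq> C" "P C"
  shows "containers \<I> q P"
  unfolding containers_def container_maps_def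
  by (rule exI[of _ "\<lambda>_. {}"], rule exI[of _ "\<lambda>_. C"]) (use assms in auto)

lemma containers_mono:
  assumes "containers \<I> q P" "\<J> \<subseteq> \<I>" "q \<le> q'" "\<And>C. P C \<Longrightarrow> P' C"
  shows "containers \<J> q' P'"
proof -
  obtain S F where "container_maps \<I> q P S F"
    using assms(1) by (rule containersE)
  note SF = container_mapsD[OF this]
  have "container_maps \<J> q' P' S F"
    unfolding container_maps_def
    using SF(1-2) order_trans[OF SF(3) assms(3)] SF(4-6) assms(4)[OF SF(7)] subsetD[OF assms(2)] by simp
  then show ?thesis
    by (rule containersI)
qed

text \<open>The second pair of maps is indexed by the container \<open>F I\<close>. Any
  \<open>J\<close> between the combined fingerprint and \<open>I\<close> has
  \<open>F J = F I\<close>, so it recovers first this index and then the data of the second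
  step.\<close>

lemma containers_bind:
  assumes 1: "containers \<I> q P"
    and 2: "\<And>C. P C \<Longrightarrow> containers {I \<in> \<I>. I \<subseteq> C} q' P'"
    and q': "q' \<ge> 0"
  shows "containers \<I> (q + q') P'"
proof -
  obtain S F where "container_maps \<I> q P S F"
    using 1 by (rule containersE)
  note SF = container_mapsD[OF this]
  \<comment> \<open>Where \<open>P C\<close> fails, the empty family is substituted: maps can then
    be chosen for every \<open>C\<close> at once, and the conditions imposed on all \<open>I\<close>
    still hold.\<close>
  have "\<forall>C. \<exists>S F. container_maps (if P C then {I \<in> \<I>. I \<subseteq> C} else {}) q' P' S F"
    using 2 containers_empty[OF q', of P'] unfolding containers_def by simp
  then obtain S' F' where "container_maps (if P C then {I \<in> \<I>. I \<subseteq> C} else {}) q' P' (S' C) (F' C)" for C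
    by metis
  note SF' = container_mapsD[OF this]
  show ?thesis
    unfolding containers_def container_maps_def
  proof (rule exI[of _ "\<lambda>I. S I \<union> S' (F I) I"], rule exI[of _ "\<lambda>I. F' (F I) I"],
      intro allI conjI impI)
    fix I
    show "S I \<union> S' (F I) I \<subseteq> I" "finite (S I \<union> S' (F I) I)"
      using SF(1,2) SF'(1,2) by auto
    have "real (card (S I \<union> S' (F I) I)) \<le> real (card (S I)) + real (card (S' (F I) I))"
      using card_Un_le[of "S I" "S' (F I) I"] by linarith
    then show "real (card (S I \<union> S' (F I) I)) \<le> q + q'"
      using SF(3)[of I] SF'(3)[of "F I" I] by linarith
  next
    fix I J assume J: "S I \<union> S' (F I) I \<subseteq> J" "J \<subseteq> I"
    then have "S J = S I" "F J = F I"
      using SF(4,5)[of I J] by auto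
    moreover have "S' (F I) J = S' (F I) I" "F' (F I) J = F' (F I) I"
      using SF'(4,5)[of "F I" I J] J by auto
    ultimately show "S J \<union> S' (F J) J = S I \<union> S' (F I) I" "F' (F J) J = F' (F I) I"
      by auto
  next
    fix I assume "I \<in> \<I>"
    then show "I \<subseteq> F' (F I) I" "P' (F' (F I) I)"
      using SF(6,7)[of I] SF'(6,7)[of I "F I"] by auto
  qed
qed

text \<open>Picking the first element of \<open>I \<inter> U\<close> in a fixed order makes the choice recoverable from every
  subset of \<open>I\<close> that still contains the picked element.\<close>

lemma containers_branch:
  assumes U: "finite U"
    and 1: "containers {I \<in> \<I>. I \<inter> U = {}} q P"
    and 2: "\<And>v. v \<in> U \<Longrightarrow> containers {I \<in> \<I>. v \<in> I} q P"
    and q: "q \<ge> 0"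
  shows "containers \<I> (q + 1) P"
proof -
  obtain rk :: "'a \<Rightarrow> nat" where rk: "inj_on rk U"
    using finite_imp_inj_to_nat_seg[OF U] by blast
  define pk where "pk I = arg_min_on rk (I \<inter> U)" for I
  have pk: "pk I \<in> I \<inter> U" if "I \<inter> U \<noteq> {}" for I
    unfolding pk_def using arg_min_if_finite(1)[of "I \<inter> U" rk] that U by auto
  have pk_least: "rk (pk I) \<le> rk y" if "y \<in> I \<inter> U" for I y
    unfolding pk_def using arg_min_least[of "I \<inter> U" y rk] that U by auto
  have pk_eq: "pk J = pk I" if "I \<inter> U \<noteq> {}" "pk I \<in> J" "J \<subseteq> I" for I J
  proof -
    have "J \<inter> U \<noteq> {}" using pk[OF that(1)] that(2) by auto
    then have "pk J \<in> J \<inter> U" by (rule pk)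
    moreover have "pk I \<in> J \<inter> U" using pk[OF that(1)] that(2) by auto
    ultimately have "rk (pk J) = rk (pk I)"
      using pk_least[of "pk J" I] pk_least[of "pk I" J] that(3) by (intro antisym) auto
    then show ?thesis
      using rk pk[OF that(1)] \<open>pk J \<in> J \<inter> U\<close> by (auto dest: inj_onD)
  qed
  obtain S F where "container_maps {I \<in> \<I>. I \<inter> U = {}} q P S F"
    using 1 by (rule containersE)
  note SF = container_mapsD[OF this]
  have "\<forall>v. \<exists>S F. container_maps (if v \<in> U then {I \<in> \<I>. v \<in> I} else {}) q P S F"
    using 2 containers_empty[OF q, of P] unfolding containers_def by simp
  then obtain S' F' where "container_maps (if v \<in> U then {I \<in> \<I>. v \<in> I} else {}) q P (S' v) (F' v)" for v
    by metis
  note SF' = container_mapsD[OF this]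
  define S2 where "S2 I = (if I \<inter> U = {} then S I else insert (pk I) (S' (pk I) I))" for I
  define F2 where "F2 I = (if I \<inter> U = {} then F I else F' (pk I) I)" for I
  show ?thesis
    unfolding containers_def container_maps_def
  proof (rule exI[of _ S2], rule exI[of _ F2], intro allI conjI impI)
    fix I
    show "S2 I \<subseteq> I" "finite (S2 I)"
      using SF(1,2) SF'(1,2) pk[of I] by (auto simp: S2_def)
    have "card (insert (pk I) (S' (pk I) I)) \<le> Suc (card (S' (pk I) I))"
      by (rule card_insert_le_m1) auto
    then show "real (card (S2 I)) \<le> q + 1"
      using SF(3)[of I] SF'(3)[of "pk I" I] by (auto simp: S2_def)
  next
    fix I J assume J: "S2 I \<subseteq> J" "J \<subseteq> I"
    have "S2 J = S2 I \<and> F2 J = F2 I"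
    proof (cases "I \<inter> U = {}")
      case True
      then have "J \<inter> U = {}" using J by auto
      then show ?thesis using True J SF(4,5)[of I J] by (auto simp: S2_def F2_def)
    next
      case False
      then have "pk J = pk I" using pk_eq[of I J] J by (auto simp: S2_def)
      moreover have "J \<inter> U \<noteq> {}" using pk[OF False] J False by (auto simp: S2_def)
      ultimately show ?thesis
        using J False SF'(4,5)[of "pk I" I J] by (auto simp: S2_def F2_def)
    qed
    then show "S2 J = S2 I" "F2 J = F2 I" by auto
  next
    fix I assume "I \<in> \<I>"
    then show "I \<subseteq> F2 I" "P (F2 I)"
      using SF(6,7)[of I] SF'(6,7)[of I "pk I"] pk[of I] by (auto simp: F2_def)
  qed
qed

section \<open>Containers for spread weights\<close>

definition weight_deg :: "'a set \<Rightarrow> ('a set \<Rightarrow> real) \<Rightarrow> 'a set \<Rightarrow> real"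
  where "weight_deg V w T = (\<Sum>A | A \<subseteq> V \<and> T \<subseteq> A. w A)"

text \<open>For finite nonempty \<open>T\<close> the bound is
  \<open>\<tau> ^ (card T - 1) / N\<close>, the codegree condition of the container method,
  normalised so that a single vertex has degree at most \<open>1 / N\<close>. The quotient avoids
  subtraction on naturals.\<close>

definition spread :: "'a set \<Rightarrow> nat \<Rightarrow> real \<Rightarrow> real \<Rightarrow> ('a set \<Rightarrow> real) \<Rightarrow> bool"
  where "spread V s \<tau> N w \<longleftrightarrow> (\<forall>A. 0 \<le> w A) \<and> (\<forall>A. w A \<noteq> 0 \<longrightarrow> A \<subseteq> V \<and> card A = s) \<and>
    (\<forall>T. T \<noteq> {} \<longrightarrow> weight_deg V w T \<le> \<tau> ^ card T / (\<tau> * N))"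

definition weight_indep :: "('a set \<Rightarrow> real) \<Rightarrow> 'a set \<Rightarrow> bool"
  where "weight_indep w I \<longleftrightarrow> (\<forall>A\<subseteq>I. w A = 0)"

text \<open>Double counting of the pairs \<open>T \<subseteq> A\<close>.\<close>

lemma sum_weight_deg:
  fixes w :: "'a set \<Rightarrow> real"
  assumes V: "finite V" and \<T>: "\<T> \<subseteq> Pow V"
  shows "(\<Sum>T\<in>\<T>. weight_deg V w T) = (\<Sum>A\<in>Pow V. real (card {T\<in>\<T>. T \<subseteq> A}) * w A)"
proof -
  have fin: "finite \<T>" using V \<T> finite_subset by blast
  have "(\<Sum>T\<in>\<T>. weight_deg V w T) = (\<Sum>T\<in>\<T>. \<Sum>A\<in>{A\<in>Pow V. T \<subseteq> A}. w A)"
    unfolding weight_deg_def by (intro sum.cong) auto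
  also have "\<dots> = (\<Sum>A\<in>Pow V. \<Sum>T\<in>{T\<in>\<T>. T \<subseteq> A}. w A)"
    by (rule sum.swap_restrict) (use V fin in auto)
  finally show ?thesis by simp
qed

lemma weight_deg_mono:
  assumes "finite V" "\<And>A. w' A \<le> w A"
  shows "weight_deg V w' T \<le> weight_deg V w T"
  unfolding weight_deg_def by (rule sum_mono) (use assms in auto)

text \<open>Inserting \<open>v\<close> is a bijection from the sets avoiding \<open>v\<close> to
  those containing it, so degrees in the link of \<open>v\<close> are degrees of \<open>w\<close> at
  one vertex more.\<close>

lemma weight_deg_link:
  assumes V: "finite V" and v: "v \<in> V" "v \<notin> T"
  shows "(\<Sum>B | B \<subseteq> V \<and> T \<subseteq> B. if v \<in> B then 0 else w (insert v B)) = weight_deg V w (insert v T)"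
proof -
  have "(\<Sum>B | B \<subseteq> V \<and> T \<subseteq> B. if v \<in> B then 0 else w (insert v B))
      = (\<Sum>B | B \<subseteq> V \<and> T \<subseteq> B \<and> v \<notin> B. w (insert v B))"
    using V by (intro sum.mono_neutral_cong_right) auto
  also have "\<dots> = (\<Sum>A | A \<subseteq> V \<and> insert v T \<subseteq> A. w A)"
    by (rule sum.reindex_bij_witness[of _ "\<lambda>A. A - {v}" "insert v"]) (use v in \<open>auto simp: insert_absorb\<close>)
  finally show ?thesis by (simp add: weight_deg_def)
qed

text \<open>Edges that contain a set \<open>T\<close> on which the link weight \<open>G\<close> is already nearly extremal are ignored.
  Every such \<open>T\<close> carries much of \<open>G\<close>, so few edges are lost as long as the mass of \<open>G\<close> is small.\<close>

lemma unsaturated_mass: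
  fixes G w :: "'a set \<Rightarrow> real"
  assumes V: "finite V" and G: "spread V s \<tau> N G" and w: "spread V (Suc s) \<tau> N w"
    and \<tau>: "\<tau> > 0" "N > 0"
    and sat: "sat = {T. T \<subseteq> V \<and> T \<noteq> {} \<and> weight_deg V G T > \<tau> ^ card T / (2 * \<tau> * N)}"
    and w': "w' = (\<lambda>A. if \<exists>T\<in>sat. T \<subseteq> A then 0 else w A)"
  shows "(\<Sum>A\<in>Pow V. w A) \<le> (\<Sum>A\<in>Pow V. w' A) + 2 ^ (s + 1) * (\<Sum>A\<in>Pow V. G A)"
proof -
  have wpos: "w A \<ge> 0" "G A \<ge> 0" for A using w G by (auto simp: spread_def)
  have satV: "sat \<subseteq> Pow V" using sat by auto
  have fsat: "finite sat" using satV V finite_subset by blast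
  have "(\<Sum>A\<in>Pow V. w A) \<le> (\<Sum>A\<in>Pow V. w' A + real (card {T\<in>sat. T \<subseteq> A}) * w A)"
  proof (rule sum_mono)
    fix A assume "A \<in> Pow V"
    show "w A \<le> w' A + real (card {T\<in>sat. T \<subseteq> A}) * w A"
    proof (cases "\<exists>T\<in>sat. T \<subseteq> A")
      case True
      then have "card {T\<in>sat. T \<subseteq> A} \<ge> 1"
        using fsat by (auto simp: Suc_le_eq card_gt_0_iff)
      then have "1 * w A \<le> real (card {T\<in>sat. T \<subseteq> A}) * w A"
        using wpos by (intro mult_right_mono) auto
      then show ?thesis using True by (simp add: w')
    next
      case False
      then show ?thesis using wpos by (simp add: w')
    qed
  qed
  also have "\<dots> = (\<Sum>A\<in>Pow V. w' A) + (\<Sum>T\<in>sat. weight_deg V w T)"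
    by (simp add: sum.distrib sum_weight_deg[OF V satV])
  \<comment> \<open>Saturation bounds the degree of \<open>w\<close> by twice that of
    \<open>G\<close>. The loss is thus charged to \<open>G\<close>, whose edges have only
    \<open>2 ^ s\<close> subsets each.\<close>
  also have "(\<Sum>T\<in>sat. weight_deg V w T) \<le> (\<Sum>T\<in>sat. 2 * weight_deg V G T)"
  proof (rule sum_mono)
    fix T assume "T \<in> sat"
    then have "T \<noteq> {}" "2 * weight_deg V G T > \<tau> ^ card T / (\<tau> * N)"
      by (auto simp: sat field_simps)
    moreover have "weight_deg V w T \<le> \<tau> ^ card T / (\<tau> * N)"
      using w \<open>T \<noteq> {}\<close> by (auto simp: spread_def)
    ultimately show "weight_deg V w T \<le> 2 * weight_deg V G T" by linarith
  qed
  also have "\<dots> = 2 * (\<Sum>A\<in>Pow V. real (card {T\<in>sat. T \<subseteq> A}) * G A)"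
    by (simp add: sum_distrib_left[symmetric] sum_weight_deg[OF V satV])
  also have "(\<Sum>A\<in>Pow V. real (card {T\<in>sat. T \<subseteq> A}) * G A) \<le> (\<Sum>A\<in>Pow V. 2 ^ s * G A)"
  proof (rule sum_mono)
    fix A assume A: "A \<in> Pow V"
    show "real (card {T\<in>sat. T \<subseteq> A}) * G A \<le> 2 ^ s * G A"
    proof (cases "G A = 0")
      case False
      then have cA: "card A = s" using G by (auto simp: spread_def)
      have fA: "finite A" using A V finite_subset by auto
      have "card {T\<in>sat. T \<subseteq> A} \<le> card (Pow A)"
        using fA by (intro card_mono) auto
      then have "real (card {T\<in>sat. T \<subseteq> A}) \<le> 2 ^ s"
        using fA cA by (simp add: card_Pow)
      then show ?thesis using wpos by (intro mult_right_mono) auto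
    qed auto
  qed
  finally show ?thesis by (simp add: sum_distrib_left[symmetric])
qed

text \<open>An unsaturated \<open>T\<close> has used at most half of its allowance. The link degree
  at \<open>T\<close> is at most \<open>\<tau> ^ card T / N\<close>, so division by
  \<open>2 * \<tau>\<close> fits it into the other half. Saturated sets gain nothing, because
  \<open>w'\<close> vanishes above them.\<close>

lemma spread_add_link:
  fixes G w :: "'a set \<Rightarrow> real"
  assumes V: "finite V" and G: "spread V s \<tau> N G" and w: "spread V (Suc s) \<tau> N w"
    and \<tau>: "\<tau> > 0" "N > 0" and v: "v \<in> V"
    and sat: "sat = {T. T \<subseteq> V \<and> T \<noteq> {} \<and> weight_deg V G T > \<tau> ^ card T / (2 * \<tau> * N)}"
    and w': "w' = (\<lambda>A. if \<exists>T\<in>sat. T \<subseteq> A then 0 else w A)"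
    and G': "G' = (\<lambda>B. G B + (if v \<in> B then 0 else w' (insert v B)) / (2 * \<tau>))"
  shows "spread V s \<tau> N G'"
    and "(\<Sum>B\<in>Pow V. G' B) = (\<Sum>B\<in>Pow V. G B) + weight_deg V w' {v} / (2 * \<tau>)"
    and "weight_indep w I \<Longrightarrow> weight_indep G I \<Longrightarrow> v \<in> I \<Longrightarrow> weight_indep G' I"
proof -
  have wpos: "w A \<ge> 0" "G A \<ge> 0" for A using w G by (auto simp: spread_def)
  have w'0: "w' A \<ge> 0" "w' A \<le> w A" for A using wpos by (auto simp: w')
  have deg: "weight_deg V G' T = weight_deg V G T
      + (\<Sum>B | B \<subseteq> V \<and> T \<subseteq> B. if v \<in> B then 0 else w' (insert v B)) / (2 * \<tau>)" for T
    unfolding weight_deg_def G' by (simp add: sum.distrib sum_divide_distrib)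
  show "spread V s \<tau> N G'"
    unfolding spread_def
  proof (intro conjI allI impI)
    show "0 \<le> G' A" for A
      using wpos w'0 \<tau> by (auto simp: G')
    fix A assume "G' A \<noteq> 0"
    then have "G A \<noteq> 0 \<or> (v \<notin> A \<and> w (insert v A) \<noteq> 0)"
      by (auto simp: G' w' split: if_splits)
    then show "A \<subseteq> V" "card A = s"
    proof (atomize (full), elim disjE)
      assume "v \<notin> A \<and> w (insert v A) \<noteq> 0"
      moreover from this have "insert v A \<subseteq> V" "card (insert v A) = Suc s"
        using w by (auto simp: spread_def)
      moreover from \<open>insert v A \<subseteq> V\<close> have "finite A" using finite_subset[OF _ V] by simp
      ultimately show "A \<subseteq> V \<and> card A = s" by auto
    qed (use G in \<open>auto simp: spread_def\<close>)
  next
    fix T :: "'a set" assume T: "T \<noteq> {}"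
    show "weight_deg V G' T \<le> \<tau> ^ card T / (\<tau> * N)"
    proof (cases "T \<subseteq> V \<and> v \<notin> T \<and> T \<notin> sat")
      case True
      have fT: "finite T" using True V finite_subset by blast
      have "(\<Sum>B | B \<subseteq> V \<and> T \<subseteq> B. if v \<in> B then 0 else w' (insert v B)) = weight_deg V w' (insert v T)"
        using True v by (intro weight_deg_link V) auto
      also have "\<dots> \<le> weight_deg V w (insert v T)"
        by (intro weight_deg_mono V w'0)
      also have "\<dots> \<le> \<tau> ^ card (insert v T) / (\<tau> * N)"
        using w by (auto simp: spread_def)
      also have "\<dots> = \<tau> ^ card T / N"
        using True fT \<tau> by simp
      finally have "(\<Sum>B | B \<subseteq> V \<and> T \<subseteq> B. if v \<in> B then 0 else w' (insert v B)) / (2 * \<tau>)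
          \<le> \<tau> ^ card T / N / (2 * \<tau>)"
        using \<tau> by (intro divide_right_mono) auto
      moreover have "weight_deg V G T \<le> \<tau> ^ card T / (2 * \<tau> * N)"
        using True T by (auto simp: sat)
      moreover have "\<tau> ^ card T / (2 * \<tau> * N) + \<tau> ^ card T / N / (2 * \<tau>) = \<tau> ^ card T / (\<tau> * N)"
        using \<tau> by (simp add: field_simps)
      ultimately show ?thesis unfolding deg by linarith
    next
      case False
      \<comment> \<open>If \<open>T\<close> leaves \<open>V\<close>, there is no such
        \<open>B\<close>; if \<open>T\<close> contains \<open>v\<close>, so does \<open>B\<close>;
        if \<open>T\<close> is saturated, \<open>w'\<close> vanishes on
        \<open>insert v B\<close>.\<close>
      have "(\<Sum>B | B \<subseteq> V \<and> T \<subseteq> B. if v \<in> B then 0 else w' (insert v B)) = 0"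
        using False by (intro sum.neutral) (auto simp: w')
      moreover have "weight_deg V G T \<le> \<tau> ^ card T / (\<tau> * N)"
        using G T by (auto simp: spread_def)
      ultimately show ?thesis unfolding deg by simp
    qed
  qed
  have "(\<Sum>B\<in>Pow V. G' B) = weight_deg V G' {}" for G'
    unfolding weight_deg_def by (intro sum.cong) auto
  then show "(\<Sum>B\<in>Pow V. G' B) = (\<Sum>B\<in>Pow V. G B) + weight_deg V w' {v} / (2 * \<tau>)"
    using weight_deg_link[OF V v, of "{}" w'] by (simp add: deg)
  show "weight_indep G' I" if "weight_indep w I" "weight_indep G I" "v \<in> I"
    using that unfolding weight_indep_def by (auto simp: G' w')
qed

lemma sum_weight_deg_singletons:
  assumes V: "finite V" and w: "\<And>A. w A \<noteq> 0 \<Longrightarrow> card A = Suc s" "\<And>A. w A \<ge> 0"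
  shows "(\<Sum>A\<in>Pow V. w A) \<le> (\<Sum>v\<in>V. weight_deg V w {v})"
proof -
  have "(\<Sum>v\<in>V. weight_deg V w {v}) = (\<Sum>T\<in>(\<lambda>v. {v}) ` V. weight_deg V w T)"
    by (simp add: sum.reindex)
  also have "\<dots> = (\<Sum>A\<in>Pow V. real (card {T\<in>(\<lambda>v. {v}) ` V. T \<subseteq> A}) * w A)"
    by (rule sum_weight_deg[OF V]) auto
  also have "\<dots> \<ge> (\<Sum>A\<in>Pow V. w A)"
  proof (rule sum_mono)
    fix A assume A: "A \<in> Pow V"
    show "w A \<le> real (card {T\<in>(\<lambda>v. {v}) ` V. T \<subseteq> A}) * w A"
    proof (cases "w A = 0")
      case False
      have "{T\<in>(\<lambda>v. {v}) ` V. T \<subseteq> A} = (\<lambda>v. {v}) ` A" using A by auto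
      then have "card {T\<in>(\<lambda>v. {v}) ` V. T \<subseteq> A} = card A" by (simp add: card_image)
      then show ?thesis using w(1)[OF False] w(2)[of A] by (simp add: algebra_simps)
    qed auto
  qed
  finally show ?thesis .
qed

text \<open>Induction on the uniformity. Positive mass on the empty set rules out independent sets
  altogether. In the step, either the independent set misses a large set of vertices of large
  degree, or the picked vertices accumulate link weight of mass \<open>\<mu>\<close>, to which
  uniformity \<open>s\<close> applies. Each uniformity costs at most \<open>3 * (\<tau> * N)\<close>
  picks.\<close>

lemma containers_spread:
  fixes \<beta> :: real
  assumes "\<beta> > 0"
  shows "\<exists>\<delta>>0. \<forall>(V :: 'a set) \<tau> N w. finite V \<longrightarrow> real (card V) \<le> N \<longrightarrow> \<tau> > 0 \<longrightarrow> 1 \<le> \<tau> * N \<longrightarrow>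
    spread V s \<tau> N w \<longrightarrow> \<beta> \<le> (\<Sum>A\<in>Pow V. w A) \<longrightarrow>
    containers {I. I \<subseteq> V \<and> weight_indep w I} (3 * real s * (\<tau> * N))
      (\<lambda>C. C \<subseteq> V \<and> real (card (V - C)) \<ge> \<delta> * N)"
  using assms
proof (induction s arbitrary: \<beta>)
  case 0
  show ?case
  proof (intro exI[of _ 1] conjI allI impI)
    fix V :: "'a set" and \<tau> N w
    assume V: "finite V" and w: "spread V 0 \<tau> N w" "\<beta> \<le> (\<Sum>A\<in>Pow V. w A)"
    have "w {} \<noteq> 0"
    proof
      assume "w {} = 0"
      have "w A = 0" if "A \<subseteq> V" for A
        using w(1) \<open>w {} = 0\<close> V finite_subset[OF that V] unfolding spread_def by (metis card_0_eq)
      then have "(\<Sum>A\<in>Pow V. w A) = 0" by (intro sum.neutral) auto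
      then show False using w(2) 0 by simp
    qed
    then have empty: "{I. I \<subseteq> V \<and> weight_indep w I} = {}" by (auto simp: weight_indep_def)
    then show "containers {I. I \<subseteq> V \<and> weight_indep w I} (3 * real 0 * (\<tau> * N))
      (\<lambda>C. C \<subseteq> V \<and> real (card (V - C)) \<ge> 1 * N)"
      by (simp only: empty) (rule containers_empty, simp)
  qed auto
next
  case (Suc s)
  \<comment> \<open>While \<open>G\<close> has mass below \<open>\<mu>\<close>, the saturated sets
    cost at most \<open>2 ^ (s + 1) * \<mu> = \<beta> / 2\<close> of the mass of
    \<open>w\<close>.\<close>
  define \<mu> where "\<mu> = \<beta> / 2 ^ (s + 2)"
  have \<mu>: "\<mu> > 0" using Suc.prems by (simp add: \<mu>_def)
  obtain \<delta>' where \<delta>': "\<delta>' > 0" and IH: "\<And>(V :: 'a set) \<tau> N w. finite V \<Longrightarrow> real (card V) \<le> N \<Longrightarrow>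
    \<tau> > 0 \<Longrightarrow> 1 \<le> \<tau> * N \<Longrightarrow> spread V s \<tau> N w \<Longrightarrow> \<mu> \<le> (\<Sum>A\<in>Pow V. w A) \<Longrightarrow>
    containers {I. I \<subseteq> V \<and> weight_indep w I} (3 * real s * (\<tau> * N))
      (\<lambda>C. C \<subseteq> V \<and> real (card (V - C)) \<ge> \<delta>' * N)"
    using Suc.IH[OF \<mu>] by blast
  define \<delta> where "\<delta> = min (\<beta> / 4) \<delta>'"
  have \<delta>: "\<delta> > 0" using \<delta>' Suc.prems by (simp add: \<delta>_def)
  show ?case
  proof (intro exI[of _ \<delta>] conjI allI impI \<delta>)
    fix V :: "'a set" and \<tau> N :: real and w
    assume V: "finite V" "real (card V) \<le> N" and \<tau>: "\<tau> > 0" "1 \<le> \<tau> * N"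
      and w: "spread V (Suc s) \<tau> N w" "\<beta> \<le> (\<Sum>A\<in>Pow V. w A)"
    have N: "N > 0" using \<tau> by (smt (verit) mult_pos_neg zero_less_mult_pos)
    let ?P = "\<lambda>C. C \<subseteq> V \<and> real (card (V - C)) \<ge> \<delta> * N"
    let ?q = "3 * real s * (\<tau> * N)"
    have q: "?q \<ge> 0" using \<tau> N by (intro mult_nonneg_nonneg) auto
    \<comment> \<open>\<open>j\<close> is the number of picks still allowed, and
      \<open>\<beta> / (8 * (\<tau> * N))\<close> is the mass that each of them is sure to add to
      \<open>G\<close>.\<close>
    have loop: "containers {I. I \<subseteq> V \<and> weight_indep w I \<and> weight_indep G I} (?q + real j) ?P"
      if "spread V s \<tau> N G" "\<mu> \<le> (\<Sum>A\<in>Pow V. G A) + real j * (\<beta> / (8 * (\<tau> * N)))" for G j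
      using that
    proof (induction j arbitrary: G)
      case (0 G)
      have "containers {I. I \<subseteq> V \<and> weight_indep G I} ?q (\<lambda>C. C \<subseteq> V \<and> real (card (V - C)) \<ge> \<delta>' * N)"
        using 0 V \<tau> by (intro IH) auto
      then show ?case
        by (rule containers_mono) (use N in \<open>auto simp: \<delta>_def min_def intro: order_trans[OF mult_right_mono]\<close>)
    next
      case (Suc j G)
      note G = Suc.prems(1)
      show ?case
      proof (cases "\<mu> \<le> (\<Sum>A\<in>Pow V. G A)")
        case True
        have "containers {I. I \<subseteq> V \<and> weight_indep G I} ?q (\<lambda>C. C \<subseteq> V \<and> real (card (V - C)) \<ge> \<delta>' * N)"
          using True G V \<tau> by (intro IH) auto
        then show ?thesis
          by (rule containers_mono) (use N in \<open>auto simp: \<delta>_def min_def intro: order_trans[OF mult_right_mono]\<close>)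
      next
        case False
        define sat where "sat = {T. T \<subseteq> V \<and> T \<noteq> {} \<and> weight_deg V G T > \<tau> ^ card T / (2 * \<tau> * N)}"
        define w' where "w' = (\<lambda>A. if \<exists>T\<in>sat. T \<subseteq> A then 0 else w A)"
        \<comment> \<open>Vertices below the threshold carry at most \<open>\<beta> / 4\<close> in
          total, as \<open>card V \<le> N\<close>. Another \<open>\<beta> / 4\<close> must lie on
          \<open>U\<close>, with at most \<open>1 / N\<close> per vertex, so \<open>U\<close> has at
          least \<open>\<beta> / 4 * N\<close> elements.\<close>
        define U where "U = {v\<in>V. weight_deg V w' {v} \<ge> \<beta> / (4 * N)}"
        have UV: "U \<subseteq> V" "finite U" using V by (auto simp: U_def)
        have w'w: "0 \<le> w' A" "w' A \<le> w A" "w' A \<noteq> 0 \<Longrightarrow> w A \<noteq> 0" for A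
          using w(1) by (auto simp: w'_def spread_def split: if_splits)
        have "2 ^ (s + 1) * (\<Sum>A\<in>Pow V. G A) \<le> 2 ^ (s + 1) * \<mu>"
          using False by (intro mult_left_mono) auto
        also have "\<dots> = \<beta> / 2"
          by (simp add: \<mu>_def)
        finally have "\<beta> / 2 \<le> (\<Sum>A\<in>Pow V. w' A)"
          using unsaturated_mass[OF V(1) G w(1) \<tau>(1) N sat_def w'_def] w(2) by linarith
        also have "\<dots> \<le> (\<Sum>v\<in>V. weight_deg V w' {v})"
          using w'w w(1) V(1) by (intro sum_weight_deg_singletons[where s = s]) (auto simp: spread_def)
        also have "\<dots> = (\<Sum>v\<in>U. weight_deg V w' {v}) + (\<Sum>v\<in>V - U. weight_deg V w' {v})"
          using UV V(1) by (metis add.commute sum.subset_diff)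
        also have "\<dots> \<le> (\<Sum>v\<in>U. 1 / N) + (\<Sum>v\<in>V - U. \<beta> / (4 * N))"
        proof (intro add_mono sum_mono)
          fix v
          have "weight_deg V w' {v} \<le> weight_deg V w {v}"
            by (intro weight_deg_mono V w'w)
          also have "\<dots> \<le> \<tau> ^ card {v} / (\<tau> * N)"
            using w(1) unfolding spread_def by blast
          finally show "weight_deg V w' {v} \<le> 1 / N" using \<tau> by simp
        qed (auto simp: U_def)
        also have "(\<Sum>v\<in>V - U. \<beta> / (4 * N)) \<le> (\<Sum>v\<in>V. \<beta> / (4 * N))"
          using V N \<open>\<beta> > 0\<close> by (intro sum_mono2) auto
        also have "\<dots> \<le> N * (\<beta> / (4 * N))"
          using V N \<open>\<beta> > 0\<close> by (simp only: sum_constant) (intro mult_right_mono, auto)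
        finally have "\<beta> / 2 \<le> real (card U) / N + \<beta> / 4"
          using N by simp
        then have cU: "\<beta> / 4 * N \<le> real (card U)"
          using N by (simp add: field_simps)
        have step1: "containers {I \<in> {I. I \<subseteq> V \<and> weight_indep w I \<and> weight_indep G I}. I \<inter> U = {}} (?q + real j) ?P"
        proof (rule containers_const[where C = "V - U"])
          have "\<delta> * N \<le> \<beta> / 4 * N" using N by (intro mult_right_mono) (auto simp: \<delta>_def)
          then have "\<delta> * N \<le> real (card U)" using cU by linarith
          moreover have "V - (V - U) = U" using UV by auto
          ultimately show "?P (V - U)" by auto
        qed (use q in auto)
        have step2: "containers {I \<in> {I. I \<subseteq> V \<and> weight_indep w I \<and> weight_indep G I}. v \<in> I} (?q + real j) ?P"
          if v: "v \<in> U" for v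
        proof -
          have vV: "v \<in> V" using v UV by auto
          define G' where "G' = (\<lambda>B. G B + (if v \<in> B then 0 else w' (insert v B)) / (2 * \<tau>))"
          note L = spread_add_link[OF V(1) G w(1) \<tau>(1) N vV sat_def w'_def G'_def]
          have "weight_deg V w' {v} / (2 * \<tau>) \<ge> \<beta> / (4 * N) / (2 * \<tau>)"
            using v \<tau> by (intro divide_right_mono) (auto simp: U_def)
          moreover have "\<beta> / (4 * N) / (2 * \<tau>) = \<beta> / (8 * (\<tau> * N))"
            using \<tau> N by (simp add: field_simps)
          ultimately have "\<mu> \<le> (\<Sum>A\<in>Pow V. G' A) + real j * (\<beta> / (8 * (\<tau> * N)))"
            using L(2) Suc.prems(2) unfolding of_nat_Suc distrib_right by linarith
          from Suc.IH[OF L(1) this] show ?thesis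
            by (rule containers_mono) (use L(3) in auto)
        qed
        have "containers {I. I \<subseteq> V \<and> weight_indep w I \<and> weight_indep G I} (?q + real j + 1) ?P"
          by (rule containers_branch[OF UV(2) step1 step2]) (use q in auto)
        then show ?thesis by (simp add: algebra_simps)
      qed
    qed
    \<comment> \<open>This many picks gain at least \<open>\<beta> / 4 \<ge> \<mu>\<close>. Rounding
      up costs at most one pick more, which \<open>1 \<le> \<tau> * N\<close> absorbs.\<close>
    define j where "j = nat \<lceil>2 * (\<tau> * N)\<rceil>"
    have j: "real j \<ge> 2 * (\<tau> * N)" "real j \<le> 3 * (\<tau> * N)"
      unfolding j_def using \<tau> by linarith+
    have "\<mu> \<le> \<beta> / 4"
      using Suc.prems unfolding \<mu>_def by (intro divide_left_mono) auto
    also have "\<dots> = 2 * (\<tau> * N) * (\<beta> / (8 * (\<tau> * N)))"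
      using \<tau> N by simp
    also have "\<dots> \<le> real j * (\<beta> / (8 * (\<tau> * N)))"
      using j \<tau> N Suc.prems by (intro mult_right_mono) auto
    finally have "\<mu> \<le> (\<Sum>A\<in>Pow V. 0) + real j * (\<beta> / (8 * (\<tau> * N)))" by simp
    moreover have "spread V s \<tau> N (\<lambda>_. 0)"
      using \<tau> N by (auto simp: spread_def weight_deg_def)
    ultimately have "containers {I. I \<subseteq> V \<and> weight_indep w I \<and> weight_indep (\<lambda>_. 0) I} (?q + real j) ?P"
      by (intro loop)
    then show "containers {I. I \<subseteq> V \<and> weight_indep w I} (3 * real (Suc s) * (\<tau> * N)) ?P"
      by (rule containers_mono) (use j in \<open>auto simp: weight_indep_def algebra_simps\<close>)
  qed
qed

text \<open>\<open>containers_spread\<close> is applied again to every container whose mass is still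
  at least \<open>\<epsilon>\<close>. Each round removes \<open>\<delta> * N\<close> vertices, so
  about \<open>1 / \<delta>\<close> rounds suffice.\<close>

lemma containers_small_mass:
  fixes \<epsilon> :: real
  assumes \<epsilon>: "\<epsilon> > 0" and s: "s > 0"
  shows "\<exists>Q>0. \<forall>(V :: 'a set) \<tau> N w. finite V \<longrightarrow> real (card V) \<le> N \<longrightarrow> \<tau> > 0 \<longrightarrow> 1 \<le> \<tau> * N \<longrightarrow>
    spread V s \<tau> N w \<longrightarrow>
    containers {I. I \<subseteq> V \<and> weight_indep w I} (Q * (\<tau> * N)) (\<lambda>C. C \<subseteq> V \<and> (\<Sum>A\<in>Pow C. w A) < \<epsilon>)"
proof -
  obtain \<delta> where \<delta>: "\<delta> > 0" and step: "\<And>(V :: 'a set) \<tau> N w. finite V \<Longrightarrow> real (card V) \<le> N \<Longrightarrow>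
    \<tau> > 0 \<Longrightarrow> 1 \<le> \<tau> * N \<Longrightarrow> spread V s \<tau> N w \<Longrightarrow> \<epsilon> \<le> (\<Sum>A\<in>Pow V. w A) \<Longrightarrow>
    containers {I. I \<subseteq> V \<and> weight_indep w I} (3 * real s * (\<tau> * N))
      (\<lambda>C. C \<subseteq> V \<and> real (card (V - C)) \<ge> \<delta> * N)"
    using containers_spread[OF \<epsilon>, of s, where 'a = 'a] by blast
  define j0 where "j0 = nat \<lceil>1 / \<delta>\<rceil>"
  have j0: "real j0 \<ge> 1 / \<delta>" unfolding j0_def by linarith
  have "1 / \<delta> > 0" using \<delta> by simp
  then have j0pos: "real j0 > 0" using j0 by linarith
  show ?thesis
  proof (intro exI[of _ "3 * real s * real j0"] conjI allI impI)
    show "0 < 3 * real s * real j0" using s j0pos by simp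
    fix V :: "'a set" and \<tau> N :: real and w
    assume V: "finite V" "real (card V) \<le> N" and \<tau>: "\<tau> > 0" "1 \<le> \<tau> * N"
      and w: "spread V s \<tau> N w"
    have N: "N > 0" using \<tau> by (smt (verit) mult_pos_neg zero_less_mult_pos)
    let ?P = "\<lambda>C. C \<subseteq> V \<and> (\<Sum>A\<in>Pow C. w A) < \<epsilon>"
    \<comment> \<open>\<open>j\<close> bounds the number of rounds left, measured by the size of
      \<open>C\<close>.\<close>
    have main: "containers {I. I \<subseteq> C \<and> weight_indep w I} (3 * real s * real j * (\<tau> * N)) ?P"
      if "C \<subseteq> V" "real (card C) \<le> real j * (\<delta> * N)" for C j
      using that
    proof (induction j arbitrary: C)
      case (0 C)
      have "C = {}" using 0 V finite_subset by fastforce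
      moreover have "w {} = 0" using w s by (auto simp: spread_def)
      ultimately show ?case
        using \<epsilon> N by (intro containers_const[where C = "{}"]) auto
    next
      case (Suc j C)
      have q: "0 \<le> 3 * real s * real j * (\<tau> * N)" for j :: nat
        using \<tau> N by (intro mult_nonneg_nonneg) auto
      show ?case
      proof (cases "(\<Sum>A\<in>Pow C. w A) < \<epsilon>")
        case True
        then show ?thesis using Suc.prems(1) q[of "Suc j"] by (intro containers_const[where C = C]) auto
      next
        case False
        \<comment> \<open>The restriction stays spread with the same \<open>\<tau>\<close> and
          \<open>N\<close>: degrees only drop, and \<open>N\<close> is merely an upper bound for the
          number of vertices.\<close>
        define wC where "wC A = (if A \<subseteq> C then w A else 0)" for A
        have fC: "finite C" using Suc.prems(1) V finite_subset by blast
        have "spread C s \<tau> N wC"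
          unfolding spread_def
        proof (intro conjI allI impI)
          fix T :: "'a set" assume T: "T \<noteq> {}"
          have "weight_deg C wC T \<le> weight_deg V w T"
            unfolding weight_deg_def wC_def
            using Suc.prems(1) V w
            by (intro order_trans[OF sum_mono sum_mono2]) (auto simp: spread_def)
          also have "\<dots> \<le> \<tau> ^ card T / (\<tau> * N)"
            using w T by (auto simp: spread_def)
          finally show "weight_deg C wC T \<le> \<tau> ^ card T / (\<tau> * N)" .
        qed (use w in \<open>auto simp: spread_def wC_def split: if_splits\<close>)
        moreover have "(\<Sum>A\<in>Pow C. wC A) = (\<Sum>A\<in>Pow C. w A)"
          by (intro sum.cong) (auto simp: wC_def)
        moreover have "real (card C) \<le> N"
          using card_mono[OF V(1) Suc.prems(1)] V(2) by linarith
        ultimately have "containers {I. I \<subseteq> C \<and> weight_indep wC I} (3 * real s * (\<tau> * N))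
            (\<lambda>C'. C' \<subseteq> C \<and> real (card (C - C')) \<ge> \<delta> * N)"
          using False \<tau> fC by (intro step) auto
        then have 1: "containers {I. I \<subseteq> C \<and> weight_indep w I} (3 * real s * (\<tau> * N))
            (\<lambda>C'. C' \<subseteq> C \<and> real (card (C - C')) \<ge> \<delta> * N)"
          by (rule containers_mono) (auto simp: weight_indep_def wC_def)
        have "containers {I. I \<subseteq> C \<and> weight_indep w I}
            (3 * real s * (\<tau> * N) + 3 * real s * real j * (\<tau> * N)) ?P"
        proof (rule containers_bind[OF 1 _ q])
          fix C' assume C': "C' \<subseteq> C \<and> real (card (C - C')) \<ge> \<delta> * N"
          have "card C = card C' + card (C - C')"
            using C' fC card_Un_disjoint[of C' "C - C'"] finite_subset[of C' C] by (simp add: Un_absorb1)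
          then have "real (card C') \<le> real j * (\<delta> * N)"
            using C' Suc.prems(2) by (simp add: algebra_simps)
          then have "containers {I. I \<subseteq> C' \<and> weight_indep w I} (3 * real s * real j * (\<tau> * N)) ?P"
            using C' Suc.prems(1) by (intro Suc.IH) auto
          then show "containers {I \<in> {I. I \<subseteq> C \<and> weight_indep w I}. I \<subseteq> C'} (3 * real s * real j * (\<tau> * N)) ?P"
            by (rule containers_mono) auto
        qed
        then show ?thesis by (simp add: algebra_simps)
      qed
    qed
    have "N = 1 / \<delta> * (\<delta> * N)" using \<delta> by simp
    also have "\<dots> \<le> real j0 * (\<delta> * N)"
      using j0 \<delta> N by (intro mult_right_mono) auto
    finally show "containers {I. I \<subseteq> V \<and> weight_indep w I} (3 * real s * real j0 * (\<tau> * N)) ?P"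
      using V by (intro main) auto
  qed
qed

section \<open>Cliques of the complete graph\<close>

abbreviation all_edges :: "nat \<Rightarrow> nat set set"
  where "all_edges n \<equiv> [{..<n}]\<^bsup>2\<^esup>"

definition cliques :: "nat \<Rightarrow> nat \<Rightarrow> nat set set set"
  where "cliques n k = (\<lambda>W. [W]\<^bsup>2\<^esup>) ` [{..<n}]\<^bsup>k\<^esup>"

lemma Union_nsets2:
  assumes "card W \<ge> 2"
  shows "\<Union>([W]\<^bsup>2\<^esup>) = W"
proof
  show "\<Union>([W]\<^bsup>2\<^esup>) \<subseteq> W" by (auto simp: nsets_def)
  show "W \<subseteq> \<Union>([W]\<^bsup>2\<^esup>)"
  proof
    fix x assume x: "x \<in> W"
    have "\<not> W \<subseteq> {x}"
    proof
      assume "W \<subseteq> {x}"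
      then have "card W \<le> card {x}" by (intro card_mono) auto
      then show False using assms by simp
    qed
    then obtain y where "y \<in> W" "y \<noteq> x" by auto
    then have "{x, y} \<in> [W]\<^bsup>2\<^esup>" using x by simp
    then show "x \<in> \<Union>([W]\<^bsup>2\<^esup>)" by blast
  qed
qed

lemma inj_on_nsets2: "k \<ge> 2 \<Longrightarrow> inj_on (\<lambda>W. [W]\<^bsup>2\<^esup>) ([V]\<^bsup>k\<^esup>)"
  by (rule inj_on_inverseI[where g = Union]) (auto simp: nsets_def[of V] Union_nsets2)

lemma finite_cliques [simp]: "finite (cliques n k)"
  by (simp add: cliques_def finite_imp_finite_nsets)

lemma cliques_subset: "A \<in> cliques n k \<Longrightarrow> A \<subseteq> all_edges n"
  unfolding cliques_def nsets_def by auto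

lemma choose_le_power: "n choose k \<le> n ^ k"
  by (cases "k \<le> n") (simp_all add: binomial_le_pow binomial_eq_0)

text \<open>\<open>W\<close> is determined by \<open>W - U\<close>, one of at most
  \<open>n ^ (k - card U)\<close> sets. The product form also covers \<open>card U > k\<close>,
  where no \<open>W\<close> exists.\<close>

lemma card_nsets_superset:
  assumes "n \<ge> 1" "finite U"
  shows "real (card {W \<in> [{..<n}]\<^bsup>k\<^esup>. U \<subseteq> W}) * real n ^ card U \<le> real n ^ k"
proof (cases "card U \<le> k")
  case True
  have "card {W \<in> [{..<n}]\<^bsup>k\<^esup>. U \<subseteq> W} \<le> card ([{..<n}]\<^bsup>(k - card U)\<^esup>)"
  proof (rule card_inj_on_le[of "\<lambda>W. W - U"])
    show "inj_on (\<lambda>W. W - U) {W \<in> [{..<n}]\<^bsup>k\<^esup>. U \<subseteq> W}"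
      by (rule inj_on_inverseI[where g = "\<lambda>W. W \<union> U"]) auto
    show "(\<lambda>W. W - U) ` {W \<in> [{..<n}]\<^bsup>k\<^esup>. U \<subseteq> W} \<subseteq> [{..<n}]\<^bsup>(k - card U)\<^esup>"
      using assms(2) by (auto simp: nsets_def card_Diff_subset)
  qed (simp add: finite_imp_finite_nsets)
  also have "\<dots> \<le> n ^ (k - card U)"
    by (simp add: choose_le_power)
  finally have "real (card {W \<in> [{..<n}]\<^bsup>k\<^esup>. U \<subseteq> W}) \<le> real n ^ (k - card U)"
    by (metis of_nat_le_iff of_nat_power)
  then have "real (card {W \<in> [{..<n}]\<^bsup>k\<^esup>. U \<subseteq> W}) * real n ^ card U
      \<le> real n ^ (k - card U) * real n ^ card U"
    by (intro mult_right_mono) auto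
  then show ?thesis using True by (simp flip: power_add)
next
  case False
  have empty: "{W \<in> [{..<n}]\<^bsup>k\<^esup>. U \<subseteq> W} = {}"
    using False by (auto simp: nsets_def dest: card_mono)
  show ?thesis by (simp only: empty) simp
qed

lemma card_le_choose_Union:
  assumes "T \<subseteq> [V]\<^bsup>2\<^esup>" "finite V"
  shows "card T \<le> card (\<Union>T) choose 2"
proof -
  have "finite (\<Union>T)"
    using assms by (intro finite_subset[of "\<Union>T" V]) (auto simp: nsets_def)
  moreover have "T \<subseteq> [\<Union>T]\<^bsup>2\<^esup>"
    using assms by (auto simp: nsets_def)
  ultimately show ?thesis
    using card_mono[of "[\<Union>T]\<^bsup>2\<^esup>" T] by (simp add: finite_imp_finite_nsets)
qed

text \<open>The edge probability at which a copy of \<open>K\<^sub>k\<close> and a single edge are expected equally often.\<close>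

definition clique_scale :: "nat \<Rightarrow> nat \<Rightarrow> real"
  where "clique_scale k n = real n powr (- 2 / (real k + 1))"

lemma clique_scale_bounds:
  assumes "n \<ge> 1"
  shows "0 < clique_scale k n" "clique_scale k n \<le> 1" "clique_scale k n * real n ^ 2 \<ge> 1"
proof -
  show "0 < clique_scale k n" using assms by (simp add: clique_scale_def)
  have "real n powr (- 2 / (real k + 1)) \<le> real n powr 0"
    using assms by (intro powr_mono) auto
  then show "clique_scale k n \<le> 1" using assms by (simp add: clique_scale_def)
  have "clique_scale k n * real n ^ 2 = real n powr (- 2 / (real k + 1) + 2)"
    using assms by (subst powr_add) (simp add: clique_scale_def)
  also have "\<dots> \<ge> real n powr 0"
    using assms by (intro powr_mono) (auto simp: field_simps)
  finally show "clique_scale k n * real n ^ 2 \<ge> 1" using assms by simp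
qed

lemma real_choose_two: "real (v choose 2) = real v * (real v - 1) / 2"
  by (cases v) (auto simp: choose_two real_of_nat_div field_simps)

text \<open>The left side is the order of the expected number of copies of \<open>K_v\<close> at
  density \<open>clique_scale k n\<close>. The exponent is concave in \<open>v\<close> and takes
  equal values at \<open>v = 2\<close> and \<open>v = k\<close>.\<close>

lemma clique_scale_power:
  assumes "n \<ge> 1"
  shows "real n ^ v * clique_scale k n ^ (v choose 2)
    = real n powr (real v * (real k + 2 - real v) / (real k + 1))"
proof -
  have "real n ^ v * clique_scale k n ^ (v choose 2)
      = real n powr (real v + real (v choose 2) * (- 2 / (real k + 1)))"
    using assms by (subst powr_add) (simp add: clique_scale_def powr_power powr_realpow)
  also have "real v + real (v choose 2) * (- 2 / (real k + 1)) = real v * (real k + 2 - real v) / (real k + 1)"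
    by (simp add: real_choose_two field_simps)
  finally show ?thesis .
qed

text \<open>By concavity the exponent is smallest at the ends of \<open>2 \<le> v \<le> k\<close>:
  the difference is a positive multiple of \<open>(v - 2) * (k - v)\<close>. A smaller
  \<open>t\<close> only helps, as \<open>clique_scale k n \<le> 1\<close>.\<close>

lemma clique_scale_deg:
  assumes "n \<ge> 1" "2 \<le> v" "v \<le> k" "t \<le> v choose 2"
  shows "real n ^ 2 * clique_scale k n \<le> real n ^ v * clique_scale k n ^ t"
proof -
  have "real 2 * (real k + 2 - real 2) \<le> real v * (real k + 2 - real v)"
  proof -
    have "0 \<le> (real v - 2) * (real k - real v)" using assms by (intro mult_nonneg_nonneg) auto
    then show ?thesis by (simp add: algebra_simps)
  qed
  then have "real n ^ 2 * clique_scale k n ^ (2 choose 2) \<le> real n ^ v * clique_scale k n ^ (v choose 2)"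
    unfolding clique_scale_power[OF assms(1)]
    using assms by (intro powr_mono divide_right_mono) auto
  also have "\<dots> \<le> real n ^ v * clique_scale k n ^ t"
    using clique_scale_bounds[OF assms(1), of k] assms(4)
    by (intro mult_left_mono power_decreasing) auto
  finally show ?thesis by simp
qed

text \<open>The normalisation turns mass below \<open>\<epsilon>\<close> into fewer than
  \<open>\<epsilon> * n ^ k\<close> copies of the clique.\<close>

definition clique_weight :: "nat \<Rightarrow> nat \<Rightarrow> nat set set \<Rightarrow> real"
  where "clique_weight n k A = (if A \<in> cliques n k then 1 / real n ^ k else 0)"

lemma sum_clique_weight:
  assumes "finite C"
  shows "(\<Sum>A\<in>Pow C. clique_weight n k A) = real (card {A \<in> cliques n k. A \<subseteq> C}) / real n ^ k"
proof -
  have "(\<Sum>A\<in>Pow C. clique_weight n k A) = (\<Sum>A\<in>{A \<in> cliques n k. A \<subseteq> C}. 1 / real n ^ k)"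
    unfolding clique_weight_def using assms by (intro sum.mono_neutral_cong_right) auto
  then show ?thesis by simp
qed

text \<open>A set \<open>T\<close> of edges that spans \<open>v\<close> vertices lies in at most
  \<open>n ^ (k - v)\<close> cliques and has at most \<open>v choose 2\<close> elements;
  \<open>clique_scale_deg\<close> compares the two.\<close>

lemma spread_clique_weight:
  assumes n: "n \<ge> 1" and k: "k \<ge> 2"
  shows "spread (all_edges n) (k choose 2) (clique_scale k n) (real n ^ 2) (clique_weight n k)"
  unfolding spread_def
proof (intro conjI allI impI)
  show "0 \<le> clique_weight n k A" for A by (simp add: clique_weight_def)
  show "A \<subseteq> all_edges n" "card A = k choose 2" if A: "clique_weight n k A \<noteq> 0" for A
  proof -
    obtain W where "A = [W]\<^bsup>2\<^esup>" "W \<subseteq> {..<n}" "card W = k"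
      using A by (auto simp: clique_weight_def cliques_def nsets_def[of "{..<n}"] split: if_splits)
    then show "A \<subseteq> all_edges n" "card A = k choose 2"
      by (simp_all add: nsets_mono)
  qed
  let ?E = "all_edges n" and ?\<tau> = "clique_scale k n"
  note \<tau> = clique_scale_bounds[OF n, of k]
  fix T :: "nat set set" assume T: "T \<noteq> {}"
  have fE: "finite ?E" by (simp add: finite_imp_finite_nsets)
  have "weight_deg ?E (clique_weight n k) T = (\<Sum>A\<in>{A \<in> cliques n k. T \<subseteq> A}. 1 / real n ^ k)"
    unfolding weight_deg_def clique_weight_def
    using fE by (intro sum.mono_neutral_cong_right) (auto dest: cliques_subset)
  then have deg: "weight_deg ?E (clique_weight n k) T = real (card {A \<in> cliques n k. T \<subseteq> A}) / real n ^ k"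
    by simp
  show "weight_deg ?E (clique_weight n k) T \<le> ?\<tau> ^ card T / (?\<tau> * real n ^ 2)"
  proof (cases "{A \<in> cliques n k. T \<subseteq> A} = {}")
    case True
    show ?thesis unfolding deg True using \<tau> by simp
  next
    case False
    then obtain W0 where W0: "W0 \<in> [{..<n}]\<^bsup>k\<^esup>" "T \<subseteq> [W0]\<^bsup>2\<^esup>"
      by (auto simp: cliques_def)
    have W0': "finite W0" "card W0 = k" using W0 by (auto simp: nsets_def)
    have UT: "\<Union>T \<subseteq> W0" using W0 by (auto simp: nsets_def)
    then have fU: "finite (\<Union>T)" using W0' finite_subset by blast
    obtain e where e: "e \<in> T" "card e = 2" using T W0 by (auto simp: nsets_def)
    have v2: "2 \<le> card (\<Union>T)"
      using card_mono[OF fU, of e] e by auto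
    have vk: "card (\<Union>T) \<le> k"
      using card_mono[OF W0'(1) UT] W0' by simp
    have "{A \<in> cliques n k. T \<subseteq> A} \<subseteq> (\<lambda>W. [W]\<^bsup>2\<^esup>) ` {W \<in> [{..<n}]\<^bsup>k\<^esup>. \<Union>T \<subseteq> W}"
      by (auto simp: cliques_def nsets_def[of _ 2])
    then have "card {A \<in> cliques n k. T \<subseteq> A} \<le> card {W \<in> [{..<n}]\<^bsup>k\<^esup>. \<Union>T \<subseteq> W}"
      by (rule surj_card_le[rotated]) (simp add: finite_imp_finite_nsets)
    then have "real (card {A \<in> cliques n k. T \<subseteq> A}) * real n ^ card (\<Union>T)
        \<le> real (card {W \<in> [{..<n}]\<^bsup>k\<^esup>. \<Union>T \<subseteq> W}) * real n ^ card (\<Union>T)"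
      by (intro mult_right_mono) auto
    also have "\<dots> \<le> real n ^ k"
      by (rule card_nsets_superset[OF n fU])
    finally have 1: "weight_deg ?E (clique_weight n k) T \<le> 1 / real n ^ card (\<Union>T)"
      unfolding deg using n by (simp add: field_simps)
    have "real n ^ 2 * ?\<tau> \<le> real n ^ card (\<Union>T) * ?\<tau> ^ card T"
      using n v2 vk card_le_choose_Union[OF W0(2) W0'(1)] by (rule clique_scale_deg)
    then have "1 / real n ^ card (\<Union>T) \<le> ?\<tau> ^ card T / (?\<tau> * real n ^ 2)"
      using n \<tau> by (simp add: field_simps)
    then show ?thesis using 1 by linarith
  qed
qed

section \<open>Ramsey's theorem and supersaturation\<close>

lemma ramsey_uniform:
  fixes k r :: nat
  assumes "k \<ge> 2"
  shows "\<exists>R\<ge>k. \<forall>(W :: nat set) f. card W = R \<longrightarrow> finite W \<longrightarrow> f \<in> [W]\<^bsup>2\<^esup> \<rightarrow> {..<r} \<longrightarrow>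
    (\<exists>i<r. \<exists>H \<in> [W]\<^bsup>k\<^esup>. \<forall>e\<in>[H]\<^bsup>2\<^esup>. f e = i)"
proof -
  obtain N where N: "partn_lst {..<N::nat} (replicate r k) 2"
    using ramsey_full by blast
  have R: "partn_lst {..<max N k} (replicate r k) 2"
    by (rule partn_lst_greater_resource[OF N]) simp
  show ?thesis
  proof (rule exI[of _ "max N k"], intro conjI allI impI)
    fix W :: "nat set" and f :: "nat set \<Rightarrow> nat"
    assume W: "card W = max N k" "finite W" and f: "f \<in> [W]\<^bsup>2\<^esup> \<rightarrow> {..<r}"
    obtain g where g: "bij_betw g {..<max N k} W"
      using ex_bij_betw_nat_finite[OF W(2)] W(1) by (auto simp: atLeast0LessThan)
    then have g': "inj_on g {..<max N k}" "g ` {..<max N k} = W" by (auto simp: bij_betw_def)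
    have fg: "f \<circ> (\<lambda>X. g ` X) \<in> [{..<max N k}]\<^bsup>2\<^esup> \<rightarrow> {..<r}"
      by (rule nsets_compose_image_funcset[OF f]) (use g' in auto)
    obtain i H where i: "i < r" and H: "H \<in> [{..<max N k}]\<^bsup>k\<^esup>"
      and mono: "(f \<circ> (\<lambda>X. g ` X)) ` [H]\<^bsup>2\<^esup> \<subseteq> {i}"
      using partn_lstE[OF R fg] by auto
    have inj: "inj_on g H" using H g'(1) by (auto simp: nsets_def intro: inj_on_subset)
    have "g ` H \<in> [W]\<^bsup>k\<^esup>"
      using H g'(2) inj by (auto simp: nsets_def card_image)
    moreover have "f e = i" if e: "e \<in> [g ` H]\<^bsup>2\<^esup>" for e
      using nset_image_obtains[OF e inj] mono by auto
    ultimately show "\<exists>i<r. \<exists>H \<in> [W]\<^bsup>k\<^esup>. \<forall>e\<in>[H]\<^bsup>2\<^esup>. f e = i"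
      using i by blast
  qed simp
qed

lemma card_UN_superset_le:
  assumes n: "n \<ge> 1" and \<U>: "finite \<U>" "\<And>U. U \<in> \<U> \<Longrightarrow> finite U \<and> card U = u"
  shows "real (card {W \<in> [{..<n}]\<^bsup>R\<^esup>. \<exists>U\<in>\<U>. U \<subseteq> W}) * real n ^ u \<le> real (card \<U>) * real n ^ R"
proof -
  have "card {W \<in> [{..<n}]\<^bsup>R\<^esup>. \<exists>U\<in>\<U>. U \<subseteq> W} = card (\<Union>U\<in>\<U>. {W \<in> [{..<n}]\<^bsup>R\<^esup>. U \<subseteq> W})"
    by (intro arg_cong[where f = card]) auto
  also have "\<dots> \<le> (\<Sum>U\<in>\<U>. card {W \<in> [{..<n}]\<^bsup>R\<^esup>. U \<subseteq> W})"
    by (rule card_UN_le[OF \<U>(1)])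
  finally have "real (card {W \<in> [{..<n}]\<^bsup>R\<^esup>. \<exists>U\<in>\<U>. U \<subseteq> W}) * real n ^ u
      \<le> (\<Sum>U\<in>\<U>. real (card {W \<in> [{..<n}]\<^bsup>R\<^esup>. U \<subseteq> W})) * real n ^ u"
    by (intro mult_right_mono) (simp_all flip: of_nat_sum)
  also have "\<dots> = (\<Sum>U\<in>\<U>. real (card {W \<in> [{..<n}]\<^bsup>R\<^esup>. U \<subseteq> W}) * real n ^ card U)"
    using \<U>(2) by (simp add: sum_distrib_right)
  also have "\<dots> \<le> (\<Sum>U\<in>\<U>. real n ^ R)"
    by (intro sum_mono card_nsets_superset n) (use \<U> in auto)
  finally show ?thesis by simp
qed

text \<open>By Ramsey's theorem every \<open>R\<close>-set contains an uncovered pair or a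
  \<open>k\<close>-set with all its pairs in one \<open>C i\<close>. The second kind makes up at
  most half of the \<open>R\<close>-sets, so many of them contain an uncovered pair, and one pair
  serves at most \<open>n ^ (R - 2)\<close> of them.\<close>

lemma ramsey_supersaturation:
  assumes k: "k \<ge> 2"
  shows "\<exists>\<epsilon>>0. \<exists>\<delta>>0. \<exists>n1. \<forall>n\<ge>n1. \<forall>C :: nat \<Rightarrow> nat set set.
    (\<forall>i<r. real (card {A \<in> cliques n k. A \<subseteq> C i}) \<le> \<epsilon> * real n ^ k) \<longrightarrow>
    real (card (all_edges n - (\<Union>i<r. C i))) \<ge> \<delta> * real n ^ 2"
proof -
  obtain R where R: "R \<ge> k" and ramsey: "\<And>(W :: nat set) f. card W = R \<Longrightarrow> finite W \<Longrightarrow>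
      f \<in> [W]\<^bsup>2\<^esup> \<rightarrow> {..<r} \<Longrightarrow> \<exists>i<r. \<exists>H \<in> [W]\<^bsup>k\<^esup>. \<forall>e\<in>[H]\<^bsup>2\<^esup>. f e = i"
    using ramsey_uniform[OF k] by metis
  \<comment> \<open>From the lower bound \<open>(n / R) ^ R\<close> for
    \<open>n choose R\<close>.\<close>
  define \<rho> where "\<rho> = 1 / real R ^ R"
  have \<rho>: "\<rho> > 0" using R k by (simp add: \<rho>_def)
  \<comment> \<open>Makes all \<open>r\<close> classes together account for at most
    \<open>\<rho> / 2 * n ^ R\<close> of the \<open>R\<close>-sets; the \<open>+ 1\<close> covers
    \<open>r = 0\<close>.\<close>
  define \<epsilon> where "\<epsilon> = \<rho> / (2 * (real r + 1))"
  have \<epsilon>: "\<epsilon> > 0" using \<rho> by (simp add: \<epsilon>_def)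
  have r\<epsilon>: "real r * \<epsilon> \<le> \<rho> / 2" using \<rho> by (simp add: \<epsilon>_def field_simps)
  show ?thesis
  proof (rule exI[of _ \<epsilon>], intro conjI \<epsilon>, rule exI[of _ "\<rho> / 2"], intro conjI,
      goal_cases)
    case 1 show ?case using \<rho> by simp
  next
    case 2
    show ?case
    proof (intro exI[of _ R] allI impI)
      fix n and C :: "nat \<Rightarrow> nat set set"
      assume nR: "R \<le> n" and C: "\<forall>i<r. real (card {A \<in> cliques n k. A \<subseteq> C i}) \<le> \<epsilon> * real n ^ k"
      have n: "n \<ge> 1" using nR R k by simp
      define D where "D = all_edges n - (\<Union>i<r. C i)"
      define B where "B i = {W \<in> [{..<n}]\<^bsup>k\<^esup>. [W]\<^bsup>2\<^esup> \<subseteq> C i}" for i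
      have fin: "finite D" "finite (B i)" for i
        by (auto simp: D_def B_def finite_imp_finite_nsets)
      have cB: "real (card (B i)) \<le> \<epsilon> * real n ^ k" if "i < r" for i
      proof -
        have "(\<lambda>W. [W]\<^bsup>2\<^esup>) ` B i \<subseteq> {A \<in> cliques n k. A \<subseteq> C i}"
          by (auto simp: B_def cliques_def)
        moreover have "inj_on (\<lambda>W. [W]\<^bsup>2\<^esup>) (B i)"
          by (rule inj_on_subset[OF inj_on_nsets2[OF k]]) (auto simp: B_def)
        ultimately have "card (B i) \<le> card {A \<in> cliques n k. A \<subseteq> C i}"
          by (intro card_inj_on_le[of "\<lambda>W. [W]\<^bsup>2\<^esup>"]) auto
        then show ?thesis using C that by fastforce
      qed
      have cover: "[{..<n}]\<^bsup>R\<^esup> \<subseteq> {W \<in> [{..<n}]\<^bsup>R\<^esup>. \<exists>U\<in>D. U \<subseteq> W} \<union>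
          (\<Union>i<r. {W \<in> [{..<n}]\<^bsup>R\<^esup>. \<exists>U\<in>B i. U \<subseteq> W})"
      proof
        fix W assume W: "W \<in> [{..<n}]\<^bsup>R\<^esup>"
        then have W': "W \<subseteq> {..<n}" "finite W" "card W = R" by (auto simp: nsets_def)
        show "W \<in> {W \<in> [{..<n}]\<^bsup>R\<^esup>. \<exists>U\<in>D. U \<subseteq> W} \<union>
          (\<Union>i<r. {W \<in> [{..<n}]\<^bsup>R\<^esup>. \<exists>U\<in>B i. U \<subseteq> W})"
        proof (cases "\<exists>U\<in>D. U \<subseteq> W")
          case False
          \<comment> \<open>The \<open>C i\<close> may overlap; the least index turns the cover into
            a colouring.\<close>
          define f where "f e = (LEAST i. e \<in> C i \<and> i < r)" for e
          have f: "e \<in> C (f e) \<and> f e < r" if "e \<in> [W]\<^bsup>2\<^esup>" for e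
          proof -
            have "e \<in> all_edges n" using that nsets_mono[OF W'(1)] by blast
            moreover have "e \<notin> D" using False that by (auto simp: nsets_def)
            ultimately obtain i where "e \<in> C i \<and> i < r" by (auto simp: D_def)
            then show ?thesis unfolding f_def by (rule LeastI)
          qed
          then obtain i H where i: "i < r" "H \<in> [W]\<^bsup>k\<^esup>" "\<forall>e\<in>[H]\<^bsup>2\<^esup>. f e = i"
            using ramsey[OF W'(3,2), of f] by blast
          have "[H]\<^bsup>2\<^esup> \<subseteq> C i"
          proof
            fix e assume e: "e \<in> [H]\<^bsup>2\<^esup>"
            then have "e \<in> [W]\<^bsup>2\<^esup>" using i(2) by (auto simp: nsets_def)
            from f[OF this] show "e \<in> C i" using i(3) e by auto
          qed
          then have "H \<in> B i" "H \<subseteq> W" using i(2) W'(1) by (auto simp: B_def nsets_def)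
          then show ?thesis using i(1) W by blast
        qed (use W in auto)
      qed
      have "real (n choose R) \<le> real (card {W \<in> [{..<n}]\<^bsup>R\<^esup>. \<exists>U\<in>D. U \<subseteq> W}) +
          (\<Sum>i<r. real (card {W \<in> [{..<n}]\<^bsup>R\<^esup>. \<exists>U\<in>B i. U \<subseteq> W}))" (is "_ \<le> ?a + (\<Sum>i<r. ?b i)")
      proof -
        have "card ([{..<n}]\<^bsup>R\<^esup>) \<le> card ({W \<in> [{..<n}]\<^bsup>R\<^esup>. \<exists>U\<in>D. U \<subseteq> W} \<union>
          (\<Union>i<r. {W \<in> [{..<n}]\<^bsup>R\<^esup>. \<exists>U\<in>B i. U \<subseteq> W}))"
          by (rule card_mono[OF _ cover]) (simp add: finite_imp_finite_nsets)
        also have "\<dots> \<le> card {W \<in> [{..<n}]\<^bsup>R\<^esup>. \<exists>U\<in>D. U \<subseteq> W} +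
            (\<Sum>i<r. card {W \<in> [{..<n}]\<^bsup>R\<^esup>. \<exists>U\<in>B i. U \<subseteq> W})"
          by (intro order_trans[OF card_Un_le] add_left_mono card_UN_le) auto
        finally show ?thesis by (simp flip: of_nat_sum of_nat_add)
      qed
      moreover have "?a * real n ^ 2 \<le> real (card D) * real n ^ R"
        using fin n by (intro card_UN_superset_le) (auto simp: D_def nsets_def)
      moreover have "(\<Sum>i<r. ?b i) \<le> \<rho> / 2 * real n ^ R"
      proof -
        have "?b i \<le> \<epsilon> * real n ^ R" if i: "i < r" for i
        proof -
          have "?b i * real n ^ k \<le> real (card (B i)) * real n ^ R"
            using fin n by (intro card_UN_superset_le) (auto simp: B_def nsets_def)
          also have "\<dots> \<le> \<epsilon> * real n ^ k * real n ^ R"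
            by (intro mult_right_mono cB i) auto
          finally show ?thesis using n by (simp add: mult.commute mult.left_commute)
        qed
        then have "(\<Sum>i<r. ?b i) \<le> (\<Sum>i<r. \<epsilon> * real n ^ R)" by (intro sum_mono) auto
        also have "\<dots> = real r * \<epsilon> * real n ^ R" by simp
        also have "\<dots> \<le> \<rho> / 2 * real n ^ R" using r\<epsilon> by (intro mult_right_mono) auto
        finally show ?thesis .
      qed
      moreover have "\<rho> * real n ^ R \<le> real (n choose R)"
        using binomial_ge_n_over_k_pow_k[OF nR, where 'a = real] by (simp add: \<rho>_def power_divide)
      ultimately have "\<rho> / 2 * real n ^ R \<le> ?a" by linarith
      then have "\<rho> / 2 * real n ^ R * real n ^ 2 \<le> ?a * real n ^ 2"
        by (intro mult_right_mono) auto
      also have "\<dots> \<le> real (card D) * real n ^ R" by fact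
      finally have "real n ^ R * (\<rho> / 2 * real n ^ 2) \<le> real n ^ R * real (card D)"
        by (simp add: mult_ac)
      then show "\<rho> / 2 * real n ^ 2 \<le> real (card (all_edges n - (\<Union>i<r. C i)))"
        using n by (simp add: D_def)
    qed
  qed
qed

text \<open>\<open>containers_small_mass\<close> on the vertex set \<open>all_edges n\<close> with
  \<open>N = n ^ 2\<close>: the clique-free graphs are the independent sets of
  \<open>clique_weight\<close>.\<close>

lemma clique_containers:
  assumes k: "k \<ge> 2" and \<epsilon>: "\<epsilon> > 0"
  shows "\<exists>Q>0. \<forall>n\<ge>1. containers {G. G \<subseteq> all_edges n \<and> (\<forall>A \<in> cliques n k. \<not> A \<subseteq> G)}
    (Q * (clique_scale k n * real n ^ 2))
    (\<lambda>C. C \<subseteq> all_edges n \<and> real (card {A \<in> cliques n k. A \<subseteq> C}) \<le> \<epsilon> * real n ^ k)"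
proof -
  have l: "k choose 2 > 0" using k by (simp add: zero_less_binomial)
  obtain Q where Q: "Q > 0" and cont: "\<And>(V :: nat set set) \<tau> N w. finite V \<Longrightarrow> real (card V) \<le> N \<Longrightarrow>
      \<tau> > 0 \<Longrightarrow> 1 \<le> \<tau> * N \<Longrightarrow> spread V (k choose 2) \<tau> N w \<Longrightarrow>
      containers {I. I \<subseteq> V \<and> weight_indep w I} (Q * (\<tau> * N)) (\<lambda>C. C \<subseteq> V \<and> (\<Sum>A\<in>Pow C. w A) < \<epsilon>)"
    using containers_small_mass[OF \<epsilon> l, where 'a = "nat set"] by blast
  show ?thesis
  proof (intro exI[of _ Q] conjI allI impI Q)
    fix n :: nat assume n: "1 \<le> n"
    have fin: "finite (all_edges n)" by (simp add: finite_imp_finite_nsets)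
    have "real (n choose 2) \<le> real n ^ 2"
      using choose_le_power[of n 2] by (metis of_nat_le_iff of_nat_power)
    then have "containers {I. I \<subseteq> all_edges n \<and> weight_indep (clique_weight n k) I}
        (Q * (clique_scale k n * real n ^ 2))
        (\<lambda>C. C \<subseteq> all_edges n \<and> (\<Sum>A\<in>Pow C. clique_weight n k A) < \<epsilon>)"
      using clique_scale_bounds[OF n, of k] fin
      by (intro cont spread_clique_weight n k) auto
    then show "containers {G. G \<subseteq> all_edges n \<and> (\<forall>A \<in> cliques n k. \<not> A \<subseteq> G)}
      (Q * (clique_scale k n * real n ^ 2))
      (\<lambda>C. C \<subseteq> all_edges n \<and> real (card {A \<in> cliques n k. A \<subseteq> C}) \<le> \<epsilon> * real n ^ k)"
    proof (rule containers_mono)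
      fix C assume C: "C \<subseteq> all_edges n \<and> (\<Sum>A\<in>Pow C. clique_weight n k A) < \<epsilon>"
      then have "finite C" using fin finite_subset by blast
      then show "C \<subseteq> all_edges n \<and> real (card {A \<in> cliques n k. A \<subseteq> C}) \<le> \<epsilon> * real n ^ k"
        using C n by (simp add: sum_clique_weight field_simps)
    qed (auto simp: weight_indep_def clique_weight_def)
  qed
qed

section \<open>Lassos and girth\<close>

definition clique_edges :: "'a set set \<Rightarrow> 'a set set"
  where "clique_edges F = (\<Union>W\<in>F. [W]\<^bsup>2\<^esup>)"

text \<open>The most recently attached clique is the head of the list.\<close>

fun tight_path :: "nat \<Rightarrow> 'a set list \<Rightarrow> bool"
  where
    "tight_path k [] \<longleftrightarrow> False"
  | "tight_path k [Q] \<longleftrightarrow> finite Q \<and> card Q = k"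
  | "tight_path k (Q # P # xs) \<longleftrightarrow> finite Q \<and> card Q = k \<and> card (Q \<inter> P) = 2 \<and>
      Q \<inter> \<Union>(set (P # xs)) \<subseteq> P \<and> tight_path k (P # xs)"

text \<open>Since \<open>Q\<close> closes a cycle and still adds an edge, in the random graph lassos are rarer than single
  edges by a power of \<open>n\<close>.\<close>

definition lasso :: "nat \<Rightarrow> 'a set \<Rightarrow> 'a set list \<Rightarrow> bool"
  where "lasso k Q xs \<longleftrightarrow> tight_path k xs \<and> finite Q \<and> card Q = k \<and>
    3 \<le> card (Q \<inter> \<Union>(set xs)) \<and> \<not> [Q]\<^bsup>2\<^esup> \<subseteq> clique_edges (set xs)"

lemma nsets2_subset_imp: "[X]\<^bsup>2\<^esup> \<subseteq> [Q]\<^bsup>2\<^esup> \<Longrightarrow> card X \<ge> 2 \<Longrightarrow> X \<subseteq> Q"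
  using Union_nsets2[of X] by (auto simp: nsets_def[of Q])

text \<open>A tight path creates no cliques besides its own. A vertex of \<open>X\<close> that lies
  only in the newest clique \<open>Q\<close> forces all its pairs, hence \<open>X\<close>, into
  \<open>Q\<close>. Without such a vertex, every pair of \<open>X\<close> inside \<open>Q\<close>
  already lies in \<open>P\<close>.\<close>

lemma clique_in_tight_path:
  assumes "tight_path k xs" "3 \<le> card X" "[X]\<^bsup>2\<^esup> \<subseteq> clique_edges (set xs)"
  shows "\<exists>P\<in>set xs. X \<subseteq> P"
  using assms
proof (induction k xs rule: tight_path.induct)
  case (2 k Q)
  then show ?case using nsets2_subset_imp[of X Q] by (auto simp: clique_edges_def)
next
  case (3 k Q P xs)
  show ?case
  proof (cases "X \<subseteq> \<Union>(set (P # xs))")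
    case True
    have "[X]\<^bsup>2\<^esup> \<subseteq> clique_edges (set (P # xs))"
    proof
      fix e assume e: "e \<in> [X]\<^bsup>2\<^esup>"
      then have "e \<in> clique_edges (set (Q # P # xs))"
        using "3.prems"(3) by blast
      then consider "e \<in> [Q]\<^bsup>2\<^esup>" | "e \<in> clique_edges (set (P # xs))"
        by (auto simp: clique_edges_def)
      then show "e \<in> clique_edges (set (P # xs))"
      proof cases
        case 1
        have "e \<subseteq> Q \<inter> \<Union>(set (P # xs))" using 1 e True by (auto simp: nsets_def)
        also have "\<dots> \<subseteq> P" using "3.prems" by simp
        finally show ?thesis using 1 by (auto simp: clique_edges_def nsets_def)
      qed
    qed
    then show ?thesis using 3 by auto
  next
    case False
    then obtain x where x: "x \<in> X" "x \<notin> \<Union>(set (P # xs))" by blast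
    have xy: "y \<in> Q \<and> x \<in> Q" if y: "y \<in> X" "y \<noteq> x" for y
    proof -
      have "{x, y} \<in> clique_edges (set (Q # P # xs))"
        using "3.prems"(3) x y by auto
      then obtain W where "W \<in> set (Q # P # xs)" "x \<in> W" "y \<in> W"
        by (auto simp: clique_edges_def)
      then show ?thesis using x by auto
    qed
    have "\<not> X \<subseteq> {x}"
      using "3.prems"(2) card_mono[of "{x}" X] by auto
    then have "X \<subseteq> Q" using xy by blast
    then show ?thesis by auto
  qed
qed auto

text \<open>If \<open>Q\<close> added no edge, it would lie inside a clique of the path by
  \<open>clique_in_tight_path\<close>, and be equal to it by cardinality.\<close>

lemma lassoI:
  assumes "tight_path k xs" "\<forall>P\<in>set xs. finite P \<and> card P = k" "finite Q" "card Q = k"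
    "Q \<notin> set xs" "3 \<le> card (Q \<inter> \<Union>(set xs))"
  shows "lasso k Q xs"
  unfolding lasso_def
proof (intro conjI assms notI)
  assume sub: "[Q]\<^bsup>2\<^esup> \<subseteq> clique_edges (set xs)"
  have "card (Q \<inter> \<Union>(set xs)) \<le> card Q" using assms by (intro card_mono) auto
  then obtain P where "P \<in> set xs" "Q \<subseteq> P"
    using clique_in_tight_path[OF assms(1) _ sub] assms by auto
  then show False using assms(2-5) card_subset_eq[of P Q] by auto
qed

text \<open>Cliques are attached starting from the end of the list. One that meets the tight path
  built so far in at least three vertices closes a lasso; otherwise it meets this path only in the
  two vertices shared with its neighbour, as tightness asks.\<close>

lemma tight_path_or_lasso:
  assumes "xs \<noteq> []" "distinct xs" "successively (\<lambda>A B. 2 \<le> card (A \<inter> B)) xs"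
    "\<forall>P\<in>set xs. finite P \<and> card P = k"
  shows "tight_path k xs \<or> (\<exists>Q ys. lasso k Q ys \<and> set (Q # ys) \<subseteq> set xs \<and> length (Q # ys) \<le> length xs)"
  using assms
proof (induction k xs rule: tight_path.induct)
  case (3 k Q P xs)
  then consider "tight_path k (P # xs)"
    | "\<exists>Q ys. lasso k Q ys \<and> set (Q # ys) \<subseteq> set (P # xs) \<and> length (Q # ys) \<le> length (P # xs)"
    by auto
  then show ?case
  proof cases
    case 1
    show ?thesis
    proof (cases "3 \<le> card (Q \<inter> \<Union>(set (P # xs)))")
      case True
      then have "lasso k Q (P # xs)" using 1 "3.prems" by (intro lassoI) auto
      then show ?thesis by (intro disjI2 exI[of _ Q] exI[of _ "P # xs"]) auto
    next
      case False
      have "Q \<inter> P = Q \<inter> \<Union>(set (P # xs))"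
      proof (rule card_seteq)
        have "2 \<le> card (Q \<inter> P)" using "3.prems" by auto
        then show "card (Q \<inter> \<Union>(set (P # xs))) \<le> card (Q \<inter> P)" using False by linarith
      qed (use "3.prems" in auto)
      moreover have "2 \<le> card (Q \<inter> P)" using "3.prems" by auto
      ultimately have "card (Q \<inter> P) = 2" "Q \<inter> \<Union>(set (P # xs)) \<subseteq> P"
        using False by auto
      then show ?thesis using 1 "3.prems" by auto
    qed
  next
    case 2
    then obtain Q' ys where "lasso k Q' ys" "set (Q' # ys) \<subseteq> set (P # xs)" "length (Q' # ys) \<le> length (P # xs)"
      by blast
    then show ?thesis by (intro disjI2 exI[of _ Q'] exI[of _ ys]) auto
  qed
qed auto

text \<open>Sharing two vertices means sharing an edge of the underlying graph. Distinctness bounds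
  the length of the connecting list by the size of \<open>F\<close>.\<close>

definition edge_connected :: "'a set set \<Rightarrow> bool"
  where "edge_connected F \<longleftrightarrow> (\<forall>A\<in>F. \<forall>B\<in>F. \<exists>xs. xs \<noteq> [] \<and> hd xs = A \<and> last xs = B \<and> set xs \<subseteq> F \<and>
    distinct xs \<and> successively (\<lambda>A B. 2 \<le> card (A \<inter> B)) xs)"

lemma edge_connected_insert:
  assumes F: "edge_connected F" and A: "A \<in> F" "2 \<le> card (K \<inter> A)" and K: "finite K" "2 \<le> card K" "K \<notin> F"
  shows "edge_connected (insert K F)"
  unfolding edge_connected_def
proof (intro ballI)
  fix B C assume B: "B \<in> insert K F" and C: "C \<in> insert K F"
  note path = F[unfolded edge_connected_def, rule_format]
  consider "B \<in> F" "C \<in> F" | "B \<in> F" "C = K" | "B = K" "C \<in> F" | "B = K" "C = K"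
    using B C by auto
  then show "\<exists>xs. xs \<noteq> [] \<and> hd xs = B \<and> last xs = C \<and> set xs \<subseteq> insert K F \<and>
    distinct xs \<and> successively (\<lambda>A B. 2 \<le> card (A \<inter> B)) xs"
  proof cases
    case 1
    then show ?thesis using path[OF 1] by blast
  next
    case 2
    obtain xs where xs: "xs \<noteq> []" "hd xs = B" "last xs = A" "set xs \<subseteq> F" "distinct xs"
        "successively (\<lambda>A B. 2 \<le> card (A \<inter> B)) xs"
      using path[OF 2(1) A(1)] by blast
    show ?thesis
      using xs 2 A K by (intro exI[of _ "xs @ [K]"]) (auto simp: successively_append_iff Int_commute)
  next
    case 3
    obtain xs where xs: "xs \<noteq> []" "hd xs = A" "last xs = C" "set xs \<subseteq> F" "distinct xs"
        "successively (\<lambda>A B. 2 \<le> card (A \<inter> B)) xs"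
      using path[OF A(1) 3(2)] by blast
    show ?thesis
      using xs 3 A K by (intro exI[of _ "K # xs"]) (auto simp: successively_Cons)
  next
    case 4
    then show ?thesis by (intro exI[of _ "[K]"]) auto
  qed
qed

lemma clique_edges_insert: "clique_edges (insert K F) = clique_edges F \<union> [K]\<^bsup>2\<^esup>"
  by (auto simp: clique_edges_def)

lemma finite_clique_edges: "finite F \<Longrightarrow> \<forall>W\<in>F. finite W \<Longrightarrow> finite (clique_edges F)"
  by (auto simp: clique_edges_def finite_imp_finite_nsets)

text \<open>Two common edges lie in cliques joined by a path inside \<open>F\<close>, which is tight
  for lack of lassos. \<open>K\<close> would contain the at least three vertices of
  \<open>e1 \<union> e2\<close> on this path and close a lasso.\<close>

lemma lasso_free_common_edge:
  assumes F: "edge_connected F" "finite F" "\<forall>W\<in>insert K F. finite W \<and> card W = k" and K: "K \<notin> F"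
    and free: "\<And>Q xs. set (Q # xs) \<subseteq> insert K F \<Longrightarrow> length (Q # xs) \<le> Suc (card F) \<Longrightarrow> \<not> lasso k Q xs"
    and e: "e1 \<in> [K]\<^bsup>2\<^esup> \<inter> clique_edges F" "e2 \<in> [K]\<^bsup>2\<^esup> \<inter> clique_edges F"
  shows "e1 = e2"
proof (rule ccontr)
  assume ne: "e1 \<noteq> e2"
  obtain A B where A: "A \<in> F" "e1 \<in> [A]\<^bsup>2\<^esup>" and B: "B \<in> F" "e2 \<in> [B]\<^bsup>2\<^esup>"
    using e by (auto simp: clique_edges_def)
  obtain xs where xs: "xs \<noteq> []" "hd xs = A" "last xs = B" "set xs \<subseteq> F" "distinct xs"
      "successively (\<lambda>A B. 2 \<le> card (A \<inter> B)) xs"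
    using F(1) A(1) B(1) unfolding edge_connected_def by blast
  have len: "length xs \<le> card F"
    using card_mono[OF F(2) xs(4)] distinct_card[OF xs(5)] by simp
  have fc: "\<forall>P\<in>set xs. finite P \<and> card P = k" using xs(4) F(3) by auto
  have "\<not> (\<exists>Q ys. lasso k Q ys \<and> set (Q # ys) \<subseteq> set xs \<and> length (Q # ys) \<le> length xs)"
    using free xs(4) len by (meson dual_order.trans le_SucI subset_insertI2)
  then have tight: "tight_path k xs"
    using tight_path_or_lasso[OF xs(1,5,6) fc] by blast
  have AB: "A \<in> set xs" "B \<in> set xs" using xs by auto
  have "e1 \<union> e2 \<subseteq> K \<inter> \<Union>(set xs)"
    using e A B AB by (auto simp: nsets_def)
  then have "card (e1 \<union> e2) \<le> card (K \<inter> \<Union>(set xs))"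
    using F(3) by (intro card_mono) auto
  moreover have "card (e1 \<union> e2) \<noteq> 2"
  proof
    assume c: "card (e1 \<union> e2) = 2"
    have f: "finite (e1 \<union> e2)" "card e1 = 2" "card e2 = 2" using e by (auto simp: nsets_def)
    have "e1 = e1 \<union> e2" "e2 = e1 \<union> e2"
      using f c by (intro card_subset_eq; simp)+
    then show False using ne by simp
  qed
  moreover have "card e1 \<le> card (e1 \<union> e2)" "card e1 = 2"
    using e card_mono[of "e1 \<union> e2" e1] by (auto simp: nsets_def)
  ultimately have "3 \<le> card (K \<inter> \<Union>(set xs))" by linarith
  then have "lasso k K xs"
    using F(3) K xs(4) fc by (intro lassoI tight) auto
  moreover have "set (K # xs) \<subseteq> insert K F" "length (K # xs) \<le> Suc (card F)" using xs(4) len by auto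
  ultimately show False using free by blast
qed

text \<open>Let \<open>l = k choose 2\<close>. Take a maximal edge-connected subfamily
  \<open>F'\<close> spanning exactly \<open>(l - 1) * card F' + 1\<close> edges. Another clique that
  shares an edge with \<open>F'\<close> shares just one and could be added, against maximality. So
  the remaining cliques are edge-disjoint from \<open>F'\<close>, and induction applies to
  them.\<close>

lemma lasso_free_span:
  assumes k: "k \<ge> 3"
    and "finite F" "F \<noteq> {}" "\<forall>W\<in>F. finite W \<and> card W = k"
    and "\<And>Q xs. set (Q # xs) \<subseteq> F \<Longrightarrow> length (Q # xs) \<le> card F \<Longrightarrow> \<not> lasso k Q xs"
  shows "card (clique_edges F) \<ge> ((k choose 2) - 1) * card F + 1"
  using assms(2-)
proof (induction "card F" arbitrary: F rule: less_induct)
  case (less F)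
  note fin = \<open>finite F\<close> and unif = \<open>\<forall>W\<in>F. finite W \<and> card W = k\<close>
  have l1: "1 \<le> k choose 2" using k by (simp add: Suc_le_eq zero_less_binomial)
  have card_K: "card ([W]\<^bsup>2\<^esup>) = k choose 2" if "W \<in> F" for W using unif that by simp
  define \<F> where "\<F> = {F'. F' \<subseteq> F \<and> F' \<noteq> {} \<and> edge_connected F' \<and>
    card (clique_edges F') = ((k choose 2) - 1) * card F' + 1}"
  have f\<F>: "finite \<F>" using fin by (simp add: \<F>_def)
  obtain W0 where W0: "W0 \<in> F" using \<open>F \<noteq> {}\<close> by auto
  have "edge_connected {W0}"
    unfolding edge_connected_def by (intro ballI exI[of _ "[W0]"]) auto
  then have "{W0} \<in> \<F>"
    using W0 card_K[OF W0] l1 by (simp add: \<F>_def clique_edges_def)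
  then obtain F' where F': "F' \<in> \<F>" and max: "\<And>G. G \<in> \<F> \<Longrightarrow> F' \<subseteq> G \<Longrightarrow> F' = G"
    using finite_has_maximal[OF f\<F>] by blast
  have sub: "F' \<subseteq> F" "F' \<noteq> {}" and conn: "edge_connected F'"
    and cF': "card (clique_edges F') = ((k choose 2) - 1) * card F' + 1"
    using F' by (auto simp: \<F>_def)
  have fF': "finite F'" using sub fin finite_subset by blast
  have fe: "finite (clique_edges F')" using sub unif fF' by (intro finite_clique_edges) auto
  show ?case
  proof (cases "F' = F")
    case True
    then show ?thesis using cF' by simp
  next
    case False
    have disj: "[K]\<^bsup>2\<^esup> \<inter> clique_edges F' = {}" if K: "K \<in> F - F'" for K
    proof (rule ccontr)
      assume "[K]\<^bsup>2\<^esup> \<inter> clique_edges F' \<noteq> {}"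
      then obtain e where e: "e \<in> [K]\<^bsup>2\<^esup> \<inter> clique_edges F'" by blast
      then obtain A where A: "A \<in> F'" "e \<in> [A]\<^bsup>2\<^esup>" by (auto simp: clique_edges_def)
      have cins: "Suc (card F') \<le> card F"
        using K sub fin fF' card_mono[of F "insert K F'"] by auto
      have eq: "[K]\<^bsup>2\<^esup> \<inter> clique_edges F' = {e}"
      proof -
        have "e' = e" if "e' \<in> [K]\<^bsup>2\<^esup> \<inter> clique_edges F'" for e'
        proof (rule lasso_free_common_edge[OF conn fF' _ _ _ that e])
          show "\<forall>W\<in>insert K F'. finite W \<and> card W = k" using unif sub K by auto
          show "\<not> lasso k Q xs" if "set (Q # xs) \<subseteq> insert K F'" "length (Q # xs) \<le> Suc (card F')" for Q xs
            using less.prems(4)[of Q xs] that cins K sub by auto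
        qed (use K in auto)
        then show ?thesis using e by blast
      qed
      have "card (clique_edges (insert K F')) = card (clique_edges F') + card ([K]\<^bsup>2\<^esup> - {e})"
      proof -
        have "clique_edges (insert K F') = clique_edges F' \<union> ([K]\<^bsup>2\<^esup> - {e})"
          using e by (auto simp: clique_edges_insert)
        moreover have "clique_edges F' \<inter> ([K]\<^bsup>2\<^esup> - {e}) = {}" using eq by blast
        moreover have "finite ([K]\<^bsup>2\<^esup>)" using K unif by (auto simp: finite_imp_finite_nsets)
        ultimately show ?thesis using fe by (simp add: card_Un_disjoint)
      qed
      also have "card ([K]\<^bsup>2\<^esup> - {e}) = (k choose 2) - 1"
        using e K card_K by auto
      finally have "card (clique_edges (insert K F')) = ((k choose 2) - 1) * card (insert K F') + 1"
        using K fF' cF' by simp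
      moreover have "edge_connected (insert K F')"
      proof (rule edge_connected_insert[OF conn A(1)])
        have "card e \<le> card (K \<inter> A)"
          using e A K unif by (intro card_mono) (auto simp: nsets_def)
        then show "2 \<le> card (K \<inter> A)" using A by (auto simp: nsets_def)
      qed (use K unif k in auto)
      ultimately have "insert K F' \<in> \<F>" using K sub by (auto simp: \<F>_def)
      then show False using max[of "insert K F'"] K by auto
    qed
    have dis: "clique_edges F' \<inter> clique_edges (F - F') = {}"
      using disj by (auto simp: clique_edges_def)
    have cF: "card F = card F' + card (F - F')"
      using sub fin by (metis card_Diff_subset card_mono fF' le_add_diff_inverse)
    have pos: "card F' > 0" using sub fF' by (simp add: card_gt_0_iff)
    have "card (clique_edges (F - F')) \<ge> ((k choose 2) - 1) * card (F - F') + 1"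
    proof (rule less.hyps)
      show "card (F - F') < card F" using cF pos by simp
      show "F - F' \<noteq> {}" using False sub by auto
      show "\<not> lasso k Q xs" if "set (Q # xs) \<subseteq> F - F'" "length (Q # xs) \<le> card (F - F')" for Q xs
        using less.prems(4)[of Q xs] that cF by auto
    qed (use fin unif in auto)
    moreover have "clique_edges F = clique_edges F' \<union> clique_edges (F - F')"
      using sub by (auto simp: clique_edges_def)
    moreover have "finite (clique_edges (F - F'))" using fin unif by (intro finite_clique_edges) auto
    ultimately have "card (clique_edges F) \<ge> (((k choose 2) - 1) * card F' + 1) + (((k choose 2) - 1) * card (F - F') + 1)"
      using dis fe cF' by (simp add: card_Un_disjoint)
    then show ?thesis by (simp add: cF distrib_left)
  qed
qed

section \<open>Random subsets\<close>

text \<open>The binomial random subset of \<open>E\<close> as a weight function on \<open>Pow E\<close>.\<close>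

definition binomial_weight :: "real \<Rightarrow> 'a set \<Rightarrow> 'a set \<Rightarrow> real"
  where "binomial_weight q E H = q ^ card H * (1 - q) ^ card (E - H)"

lemma binomial_weight_nonneg: "0 \<le> q \<Longrightarrow> q \<le> 1 \<Longrightarrow> 0 \<le> binomial_weight q E H"
  by (simp add: binomial_weight_def)

text \<open>The expectation of \<open>x ^ card (H \<inter> D)\<close> on the event
  \<open>S \<subseteq> H\<close>. Elements are chosen independently, so it factorises over
  \<open>E\<close>.\<close>

lemma sum_binomial_weight_tilted:
  fixes q x :: real
  assumes E: "finite E" and SD: "S \<subseteq> E" "D \<subseteq> E" "S \<inter> D = {}"
  shows "(\<Sum>H\<in>Pow E. binomial_weight q E H * (if S \<subseteq> H then x ^ card (H \<inter> D) else 0))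
    = q ^ card S * (1 - q + q * x) ^ card D"
proof -
  define f where "f e = q * (if e \<in> D then x else 1)" for e
  \<comment> \<open>Weight zero for omitting an element of \<open>S\<close> enforces
    \<open>S \<subseteq> H\<close>.\<close>
  define g where "g e = (if e \<in> S then 0 else 1 - q)" for e
  have "(\<Sum>H\<in>Pow E. binomial_weight q E H * (if S \<subseteq> H then x ^ card (H \<inter> D) else 0))
      = (\<Sum>H\<in>Pow E. (\<Prod>e\<in>H. f e) * (\<Prod>e\<in>E - H. g e))"
  proof (rule sum.cong)
    fix H assume H: "H \<in> Pow E"
    then have fH: "finite H" using E finite_subset by auto
    have "(\<Prod>e\<in>H. f e) = q ^ card H * x ^ card (H \<inter> D)"
      using fH by (simp add: f_def prod.distrib prod.If_cases)
    moreover have "(\<Prod>e\<in>E - H. g e) = (if S \<subseteq> H then (1 - q) ^ card (E - H) else 0)"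
    proof (cases "S \<subseteq> H")
      case True
      then have "(\<Prod>e\<in>E - H. g e) = (\<Prod>e\<in>E - H. 1 - q)"
        by (intro prod.cong) (auto simp: g_def)
      then show ?thesis using True by simp
    next
      case False
      then obtain e where "e \<in> S" "e \<notin> H" by auto
      then have "\<exists>e\<in>E - H. g e = 0" using SD by (auto simp: g_def)
      then show ?thesis using E False by auto
    qed
    ultimately show "binomial_weight q E H * (if S \<subseteq> H then x ^ card (H \<inter> D) else 0) =
        (\<Prod>e\<in>H. f e) * (\<Prod>e\<in>E - H. g e)"
      by (simp add: binomial_weight_def)
  qed simp
  also have "\<dots> = (\<Prod>e\<in>E. f e + g e)"
    by (rule prod_add[OF E, symmetric])
  also have "\<dots> = (\<Prod>e\<in>E. (if e \<in> S then q else 1) * (if e \<in> D then 1 - q + q * x else 1))"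
    using SD by (intro prod.cong) (auto simp: f_def g_def)
  also have "\<dots> = q ^ card (E \<inter> S) * (1 - q + q * x) ^ card (E \<inter> D)"
    using E by (simp add: prod.distrib prod.If_cases)
  also have "\<dots> = q ^ card S * (1 - q + q * x) ^ card D"
    using SD by (simp add: Int_absorb1)
  finally show ?thesis .
qed

lemma sum_binomial_weight_supersets:
  assumes "finite E" "S \<subseteq> E"
  shows "(\<Sum>H\<in>Pow E. binomial_weight q E H * (if S \<subseteq> H then 1 else 0)) = q ^ card S"
  using sum_binomial_weight_tilted[OF assms, of "{}" q 1] by (simp cong: if_cong)

lemma sum_binomial_weight: "finite E \<Longrightarrow> (\<Sum>H\<in>Pow E. binomial_weight q E H) = 1"
  using sum_binomial_weight_supersets[of E "{}" q] by simp

text \<open>Inserting \<open>x powr (card A - m) \<ge> 1\<close> turns the truncated sum into a full binomial expansion.\<close>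

lemma sum_power_card_le:
  fixes q x m :: real
  assumes E: "finite E" and q: "0 \<le> q" and x: "0 < x" "x \<le> 1"
  shows "(\<Sum>A | A \<subseteq> E \<and> real (card A) \<le> m. q ^ card A) \<le> exp (m * ln (1 / x) + q * x * real (card E))"
proof -
  have "(\<Sum>A | A \<subseteq> E \<and> real (card A) \<le> m. q ^ card A)
      \<le> (\<Sum>A | A \<subseteq> E \<and> real (card A) \<le> m. x powr (- m) * (q * x) ^ card A)"
  proof (rule sum_mono)
    fix A assume A: "A \<in> {A. A \<subseteq> E \<and> real (card A) \<le> m}"
    have "x powr (- m) * x ^ card A = x powr (real (card A) - m)"
      using x by (simp add: powr_diff powr_minus powr_realpow field_simps)
    moreover have "x powr (real (card A) - m) \<ge> x powr 0"
      using x A by (intro powr_mono') auto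
    ultimately have "1 \<le> x powr (- m) * x ^ card A" using x by simp
    then have "q ^ card A * 1 \<le> q ^ card A * (x powr (- m) * x ^ card A)"
      using q by (intro mult_left_mono) auto
    then show "q ^ card A \<le> x powr (- m) * (q * x) ^ card A"
      by (simp add: power_mult_distrib mult_ac)
  qed
  also have "\<dots> \<le> (\<Sum>A\<in>Pow E. x powr (- m) * (q * x) ^ card A)"
    using E q x by (intro sum_mono2) auto
  also have "\<dots> = x powr (- m) * (\<Sum>A\<in>Pow E. (\<Prod>e\<in>A. q * x) * (\<Prod>e\<in>E - A. 1))"
    by (simp add: sum_distrib_left)
  also have "\<dots> = x powr (- m) * (q * x + 1) ^ card E"
    using prod_add[OF E, of "\<lambda>_. q * x" "\<lambda>_. 1"] by simp
  also have "\<dots> \<le> x powr (- m) * exp (q * x) ^ card E"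
    using q x exp_ge_add_one_self[of "q * x"]
    by (intro mult_left_mono power_mono) (auto simp: add.commute)
  also have "\<dots> = exp (m * ln (1 / x) + q * x * real (card E))"
    using x by (simp add: powr_def ln_div exp_of_nat_mult[symmetric] mult.commute flip: exp_add)
  finally show ?thesis .
qed

text \<open>An exponential Markov bound for the event that \<open>H\<close> contains the
  fingerprints but few elements of \<open>D S\<close>. By disjointness the probability of containing
  the fingerprints is the product of the \<open>q ^ card (S i)\<close>, which pays for the number of
  choices of fingerprints.\<close>

lemma union_bound_fingerprints:
  fixes q x m d a :: real
  assumes E: "finite E" and q: "0 \<le> q" "q \<le> 1" and x: "0 < x" "x \<le> 1"
    and \<T>: "\<T> \<subseteq> PiE {..<r::nat} (\<lambda>_. {A. A \<subseteq> E \<and> real (card A) \<le> m})"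
    and S: "\<And>S i j. S \<in> \<T> \<Longrightarrow> i < r \<Longrightarrow> j < r \<Longrightarrow> i \<noteq> j \<Longrightarrow> S i \<inter> S j = {}"
    and D: "\<And>S. S \<in> \<T> \<Longrightarrow> D S \<subseteq> E" "\<And>S. S \<in> \<T> \<Longrightarrow> (\<Union>i<r. S i) \<inter> D S = {}"
      "\<And>S. S \<in> \<T> \<Longrightarrow> d \<le> real (card (D S))"
    and Bad: "Bad \<subseteq> Pow E"
      "\<And>H. H \<in> Bad \<Longrightarrow> \<exists>S\<in>\<T>. (\<Union>i<r. S i) \<subseteq> H \<and> real (card (H \<inter> D S)) \<le> a"
  shows "(\<Sum>H\<in>Bad. binomial_weight q E H)
    \<le> exp (a * ln 2 - q * d / 2 + real r * (m * ln (1 / x) + q * x * real (card E)))"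
proof -
  let ?w = "binomial_weight q E"
  define U where "U S = (\<Union>i<r. S i)" for S :: "nat \<Rightarrow> 'a set"
  have w: "?w H \<ge> 0" for H using q by (rule binomial_weight_nonneg)
  have finA: "finite {A. A \<subseteq> E \<and> real (card A) \<le> m}" using E by simp
  have finPi: "finite (PiE {..<r} (\<lambda>_. {A. A \<subseteq> E \<and> real (card A) \<le> m}))"
    using finA by (intro finite_PiE) auto
  have fin\<T>: "finite \<T>" using finite_subset[OF \<T> finPi] .
  have SE: "S i \<subseteq> E" if "S \<in> \<T>" "i < r" for S i using \<T> that by (auto dest: PiE_mem)
  have UE: "U S \<subseteq> E" if "S \<in> \<T>" for S using SE that by (auto simp: U_def)
  \<comment> \<open>If \<open>H\<close> is bad because of \<open>S\<close>, then
    \<open>2 powr a * t H S \<ge> 1\<close>. The base \<open>1 / 2\<close> yields a factor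
    \<open>1 - q / 2 \<le> exp (- (q / 2))\<close> for each element of \<open>D S\<close>.\<close>
  define t where "t H S = (if U S \<subseteq> H then (1 / 2) ^ card (H \<inter> D S) else (0::real))" for H S
  have t: "t H S \<ge> 0" for H S by (simp add: t_def)
  have "(\<Sum>H\<in>Bad. ?w H) \<le> (\<Sum>H\<in>Bad. \<Sum>S\<in>\<T>. 2 powr a * (?w H * t H S))"
  proof (rule sum_mono)
    fix H assume "H \<in> Bad"
    then obtain S where S: "S \<in> \<T>" "U S \<subseteq> H" "real (card (H \<inter> D S)) \<le> a"
      using Bad(2) unfolding U_def by blast
    have "2 powr a * t H S = 2 powr (a - real (card (H \<inter> D S)))"
      using S by (simp add: t_def powr_diff powr_realpow power_divide)
    also have "\<dots> \<ge> 2 powr 0" using S by (intro powr_mono) auto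
    finally have "1 \<le> 2 powr a * t H S" by simp
    then have "?w H * 1 \<le> ?w H * (2 powr a * t H S)" using w by (intro mult_left_mono) auto
    also have "\<dots> = 2 powr a * (?w H * t H S)" by simp
    also have "\<dots> \<le> (\<Sum>S\<in>\<T>. 2 powr a * (?w H * t H S))"
      using w t fin\<T> S by (intro member_le_sum) auto
    finally show "?w H \<le> (\<Sum>S\<in>\<T>. 2 powr a * (?w H * t H S))" by simp
  qed
  also have "\<dots> \<le> (\<Sum>H\<in>Pow E. \<Sum>S\<in>\<T>. 2 powr a * (?w H * t H S))"
    using E Bad w t by (intro sum_mono2 sum_nonneg) auto
  also have "\<dots> = (\<Sum>S\<in>\<T>. 2 powr a * (\<Sum>H\<in>Pow E. ?w H * t H S))"
    by (subst sum.swap) (simp add: sum_distrib_left)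
  also have "\<dots> \<le> (\<Sum>S\<in>\<T>. 2 powr a * (exp (- (q * d / 2)) * (\<Prod>i<r. q ^ card (S i))))"
  proof (intro sum_mono mult_left_mono)
    fix S' assume S': "S' \<in> \<T>"
    have "(\<Sum>H\<in>Pow E. ?w H * t H S') = q ^ card (U S') * (1 - q + q * (1 / 2)) ^ card (D S')"
      unfolding t_def using S' D UE by (intro sum_binomial_weight_tilted E) (auto simp: U_def)
    also have "\<dots> \<le> q ^ card (U S') * exp (- (q / 2)) ^ card (D S')"
      using q exp_ge_add_one_self[of "- (q / 2)"] by (intro mult_left_mono power_mono) auto
    also have "exp (- (q / 2)) ^ card (D S') = exp (- (q * real (card (D S')) / 2))"
      by (simp add: exp_of_nat_mult[symmetric] mult.commute)
    also have "q ^ card (U S') * exp (- (q * real (card (D S')) / 2)) \<le> q ^ card (U S') * exp (- (q * d / 2))"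
      using q D(3)[OF S'] by (intro mult_left_mono) (auto intro: mult_left_mono)
    also have "card (U S') = (\<Sum>i<r. card (S' i))"
      unfolding U_def using S[OF S'] finite_subset[OF SE[OF S'] E]
      by (intro card_UN_disjoint) auto
    finally show "(\<Sum>H\<in>Pow E. ?w H * t H S') \<le> exp (- (q * d / 2)) * (\<Prod>i<r. q ^ card (S' i))"
      by (simp add: power_sum mult.commute)
  qed auto
  also have "\<dots> = 2 powr a * exp (- (q * d / 2)) * (\<Sum>S\<in>\<T>. \<Prod>i<r. q ^ card (S i))"
    by (simp add: sum_distrib_left mult.assoc)
  also have "\<dots> \<le> 2 powr a * exp (- (q * d / 2)) *
      (\<Sum>S\<in>PiE {..<r} (\<lambda>_. {A. A \<subseteq> E \<and> real (card A) \<le> m}). \<Prod>i<r. q ^ card (S i))"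
    using q by (intro mult_left_mono sum_mono2 finPi \<T> prod_nonneg) auto
  also have "(\<Sum>S\<in>PiE {..<r} (\<lambda>_. {A. A \<subseteq> E \<and> real (card A) \<le> m}). \<Prod>i<r. q ^ card (S i))
      = (\<Sum>A | A \<subseteq> E \<and> real (card A) \<le> m. q ^ card A) ^ r"
    using prod_sum_PiE[of "{..<r}" "\<lambda>_. {A. A \<subseteq> E \<and> real (card A) \<le> m}" "\<lambda>_ A. q ^ card A"] finA
    by simp
  also have "\<dots> \<le> exp (m * ln (1 / x) + q * x * real (card E)) ^ r"
    using sum_power_card_le[OF E q(1) x] q by (intro power_mono sum_nonneg) auto
  also have "\<dots> = exp (real r * (m * ln (1 / x) + q * x * real (card E)))"
    by (simp add: exp_of_nat_mult[symmetric])
  also have "2 powr a * exp (- (q * d / 2)) * \<dots>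
      = exp (a * ln 2 - q * d / 2 + real r * (m * ln (1 / x) + q * x * real (card E)))"
    by (simp add: powr_def flip: exp_add)
  finally show ?thesis by simp
qed

section \<open>Expected numbers of tight paths and lassos\<close>

lemma card_nsets_meet:
  assumes P: "finite P"
  shows "card {Q \<in> [{..<n}]\<^bsup>k\<^esup>. card (Q \<inter> P) = j} \<le> card P ^ j * n ^ (k - j)"
proof -
  have "card {Q \<in> [{..<n}]\<^bsup>k\<^esup>. card (Q \<inter> P) = j} \<le> card ([P]\<^bsup>j\<^esup> \<times> [{..<n}]\<^bsup>(k - j)\<^esup>)"
  proof (rule card_inj_on_le[of "\<lambda>Q. (Q \<inter> P, Q - P)"])
    show "inj_on (\<lambda>Q. (Q \<inter> P, Q - P)) {Q \<in> [{..<n}]\<^bsup>k\<^esup>. card (Q \<inter> P) = j}"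
      by (rule inj_on_inverseI[where g = "\<lambda>(A, B). A \<union> B"]) auto
    show "(\<lambda>Q. (Q \<inter> P, Q - P)) ` {Q \<in> [{..<n}]\<^bsup>k\<^esup>. card (Q \<inter> P) = j}
        \<subseteq> [P]\<^bsup>j\<^esup> \<times> [{..<n}]\<^bsup>(k - j)\<^esup>"
      using P by (auto simp: nsets_def card_Diff_subset_Int)
    show "finite ([P]\<^bsup>j\<^esup> \<times> [{..<n}]\<^bsup>(k - j)\<^esup>)"
      using P by (simp add: finite_imp_finite_nsets)
  qed
  also have "\<dots> \<le> card P ^ j * n ^ (k - j)"
    by (simp add: card_cartesian_product mult_le_mono choose_le_power)
  finally show ?thesis .
qed

text \<open>A pair of \<open>Q\<close> covered by \<open>F\<close> lies inside
  \<open>Q \<inter> \<Union>F\<close>; all other pairs of \<open>Q\<close> are new.\<close>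

lemma card_clique_edges_insert_ge:
  assumes F: "finite F" "\<forall>W\<in>F. finite W" and Q: "finite Q" "card Q = k"
  shows "card (clique_edges F) + ((k choose 2) - (card (Q \<inter> \<Union>F) choose 2)) \<le> card (clique_edges (insert Q F))"
    and "\<not> [Q]\<^bsup>2\<^esup> \<subseteq> clique_edges F \<Longrightarrow> card (clique_edges F) < card (clique_edges (insert Q F))"
proof -
  have fin: "finite (clique_edges F)" "finite ([Q]\<^bsup>2\<^esup>)" "finite ([Q \<inter> \<Union>F]\<^bsup>2\<^esup>)"
    using F Q finite_clique_edges by (auto simp: finite_imp_finite_nsets)
  have "[Q]\<^bsup>2\<^esup> - [Q \<inter> \<Union>F]\<^bsup>2\<^esup> \<subseteq> [Q]\<^bsup>2\<^esup> - clique_edges F"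
    by (auto simp: clique_edges_def nsets_def)
  then have "card ([Q]\<^bsup>2\<^esup> - [Q \<inter> \<Union>F]\<^bsup>2\<^esup>) \<le> card ([Q]\<^bsup>2\<^esup> - clique_edges F)"
    using fin by (intro card_mono) auto
  moreover have "card ([Q]\<^bsup>2\<^esup>) - card ([Q \<inter> \<Union>F]\<^bsup>2\<^esup>) \<le> card ([Q]\<^bsup>2\<^esup> - [Q \<inter> \<Union>F]\<^bsup>2\<^esup>)"
    using fin by (intro diff_card_le_card_Diff)
  moreover have "clique_edges (insert Q F) = clique_edges F \<union> ([Q]\<^bsup>2\<^esup> - clique_edges F)"
    by (auto simp: clique_edges_insert)
  then have *: "card (clique_edges (insert Q F)) = card (clique_edges F) + card ([Q]\<^bsup>2\<^esup> - clique_edges F)"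
    using fin card_Un_disjoint[of "clique_edges F" "[Q]\<^bsup>2\<^esup> - clique_edges F"] by auto
  ultimately show "card (clique_edges F) + ((k choose 2) - (card (Q \<inter> \<Union>F) choose 2)) \<le> card (clique_edges (insert Q F))"
    using Q by simp
  assume "\<not> [Q]\<^bsup>2\<^esup> \<subseteq> clique_edges F"
  then have "[Q]\<^bsup>2\<^esup> - clique_edges F \<noteq> {}" by auto
  then show "card (clique_edges F) < card (clique_edges (insert Q F))"
    using * fin by (simp add: card_gt_0_iff)
qed

text \<open>\<open>t\<close> counts the cliques attached to the initial one.\<close>

definition tight_paths :: "nat \<Rightarrow> nat \<Rightarrow> nat \<Rightarrow> nat set list set"
  where "tight_paths n k t = {xs. length xs = Suc t \<and> tight_path k xs \<and> set xs \<subseteq> Pow {..<n}}"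

lemma finite_tight_paths [simp]: "finite (tight_paths n k t)"
  by (rule finite_subset[OF _ finite_lists_length_eq[of "Pow {..<n}" "Suc t"]])
    (auto simp: tight_paths_def)

lemma tight_path_members: "tight_path k xs \<Longrightarrow> P \<in> set xs \<Longrightarrow> finite P \<and> card P = k"
  by (induction k xs rule: tight_path.induct) auto

text \<open>The sum is the expected number of tight paths in the random graph. For an attached
  clique there are at most \<open>k ^ 2\<close> choices of the shared pair and
  \<open>n ^ (k - 2)\<close> of the other vertices, and it adds at least \<open>l - 1\<close>
  edges.\<close>

lemma sum_tight_paths:
  fixes q :: real
  assumes q: "0 \<le> q" "q \<le> 1" and k: "k \<ge> 2"
  defines "l \<equiv> k choose 2"
  shows "(\<Sum>xs\<in>tight_paths n k t. q ^ card (clique_edges (set xs)))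
    \<le> real n ^ k * q ^ l * (real k ^ 2 * real n ^ (k - 2) * q ^ (l - 1)) ^ t"
proof (induction t)
  case 0
  have "tight_paths n k 0 = (\<lambda>Q. [Q]) ` [{..<n}]\<^bsup>k\<^esup>"
    by (auto simp: tight_paths_def length_Suc_conv nsets_def)
  then have "(\<Sum>xs\<in>tight_paths n k 0. q ^ card (clique_edges (set xs)))
      = (\<Sum>Q\<in>[{..<n}]\<^bsup>k\<^esup>. q ^ card ([Q]\<^bsup>2\<^esup>))"
    by (simp add: sum.reindex inj_on_def clique_edges_def)
  also have "\<dots> = (\<Sum>Q\<in>[{..<n}]\<^bsup>k\<^esup>. q ^ l)"
    by (intro sum.cong) (auto simp: nsets_def[of "{..<n}"] l_def)
  also have "\<dots> \<le> real n ^ k * q ^ l"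
    using q choose_le_power[of n k] by (auto intro!: mult_right_mono simp flip: of_nat_power)
  finally show ?case by simp
next
  case (Suc t)
  let ?ext = "\<lambda>xs. {Q \<in> [{..<n}]\<^bsup>k\<^esup>. card (Q \<inter> hd xs) = 2 \<and> tight_path k (Q # xs)}"
  let ?c = "real k ^ 2 * real n ^ (k - 2) * q ^ (l - 1)"
  have fext: "finite (?ext xs)" for xs by (simp add: finite_imp_finite_nsets)
  have "tight_paths n k (Suc t) = (\<lambda>(xs, Q). Q # xs) ` (SIGMA xs:tight_paths n k t. ?ext xs)"
  proof (intro equalityI subsetI)
    fix ys assume ys: "ys \<in> tight_paths n k (Suc t)"
    then obtain Q P xs where "ys = Q # P # xs"
      by (auto simp: tight_paths_def length_Suc_conv)
    then show "ys \<in> (\<lambda>(xs, Q). Q # xs) ` (SIGMA xs:tight_paths n k t. ?ext xs)"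
      using ys by (intro image_eqI[of _ _ "(P # xs, Q)"]) (auto simp: tight_paths_def nsets_def)
  next
    fix ys assume "ys \<in> (\<lambda>(xs, Q). Q # xs) ` (SIGMA xs:tight_paths n k t. ?ext xs)"
    then show "ys \<in> tight_paths n k (Suc t)"
      by (force simp: tight_paths_def nsets_def)
  qed
  moreover have "inj_on (\<lambda>(xs, Q). Q # xs) (SIGMA xs:tight_paths n k t. ?ext xs)"
    by (auto simp: inj_on_def)
  ultimately have "(\<Sum>ys\<in>tight_paths n k (Suc t). q ^ card (clique_edges (set ys)))
      = (\<Sum>xs\<in>tight_paths n k t. \<Sum>Q\<in>?ext xs. q ^ card (clique_edges (insert Q (set xs))))"
    using fext by (simp add: sum.reindex sum.Sigma case_prod_unfold)
  also have "\<dots> \<le> (\<Sum>xs\<in>tight_paths n k t. q ^ card (clique_edges (set xs)) * ?c)"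
  proof (rule sum_mono)
    fix xs assume xs: "xs \<in> tight_paths n k t"
    then have mem: "\<forall>P\<in>set xs. finite P \<and> card P = k" and ne: "xs \<noteq> []"
      using tight_path_members by (auto simp: tight_paths_def)
    have hd: "finite (hd xs)" "card (hd xs) = k" using mem ne by auto
    have "(\<Sum>Q\<in>?ext xs. q ^ card (clique_edges (insert Q (set xs))))
        \<le> (\<Sum>Q\<in>?ext xs. q ^ (card (clique_edges (set xs)) + (l - 1)))"
    proof (rule sum_mono)
      fix Q assume Q: "Q \<in> ?ext xs"
      obtain P ys where P: "xs = P # ys" using ne by (cases xs) auto
      have "Q \<inter> \<Union>(set xs) = Q \<inter> P" "card (Q \<inter> P) = 2" using Q P by auto
      then have "card (Q \<inter> \<Union>(set xs)) choose 2 = 1" by simp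
      then have "card (clique_edges (set xs)) + (l - 1) \<le> card (clique_edges (insert Q (set xs)))"
        using card_clique_edges_insert_ge(1)[of "set xs" Q k] mem Q by (auto simp: l_def nsets_def)
      then show "q ^ card (clique_edges (insert Q (set xs))) \<le> q ^ (card (clique_edges (set xs)) + (l - 1))"
        using q by (intro power_decreasing) auto
    qed
    also have "\<dots> = real (card (?ext xs)) * q ^ (card (clique_edges (set xs)) + (l - 1))" by simp
    also have "\<dots> \<le> (real k ^ 2 * real n ^ (k - 2)) * q ^ (card (clique_edges (set xs)) + (l - 1))"
    proof (intro mult_right_mono)
      have "card (?ext xs) \<le> card {Q \<in> [{..<n}]\<^bsup>k\<^esup>. card (Q \<inter> hd xs) = 2}"
        by (intro card_mono) (auto simp: finite_imp_finite_nsets)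
      also have "\<dots> \<le> k ^ 2 * n ^ (k - 2)" using card_nsets_meet[OF hd(1), of n k 2] hd(2) by simp
      finally have "real (card (?ext xs)) \<le> real (k ^ 2 * n ^ (k - 2))" by (rule of_nat_mono)
      then show "real (card (?ext xs)) \<le> real k ^ 2 * real n ^ (k - 2)" by simp
    qed (use q in auto)
    finally show "(\<Sum>Q\<in>?ext xs. q ^ card (clique_edges (insert Q (set xs))))
        \<le> q ^ card (clique_edges (set xs)) * ?c"
      by (simp add: power_add mult_ac)
  qed
  also have "\<dots> = (\<Sum>xs\<in>tight_paths n k t. q ^ card (clique_edges (set xs))) * ?c"
    by (simp add: sum_distrib_right)
  also have "\<dots> \<le> (real n ^ k * q ^ l * ?c ^ t) * ?c"
    using Suc q by (intro mult_right_mono) auto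
  finally show ?case by (simp add: mult_ac)
qed

definition lassos :: "nat \<Rightarrow> nat \<Rightarrow> nat \<Rightarrow> (nat set list \<times> nat set) set"
  where "lassos n k t = (SIGMA xs:tight_paths n k t. {Q \<in> [{..<n}]\<^bsup>k\<^esup>. lasso k Q xs})"

lemma finite_lassos [simp]: "finite (lassos n k t)"
  by (auto simp: lassos_def finite_imp_finite_nsets)

text \<open>The closing clique is classified by the number \<open>j\<close> of its vertices on the
  path, giving at most \<open>(k * Suc t) ^ j * n ^ (k - j)\<close> choices. The
  \<open>max 1\<close> records the new edge that a lasso guarantees even if all of \<open>Q\<close>
  lies on the path.\<close>

lemma sum_lassos:
  fixes q \<eta> :: real
  assumes q: "0 \<le> q" "q \<le> 1" and k: "k \<ge> 2"
    and \<eta>: "\<And>j. 3 \<le> j \<Longrightarrow> j \<le> k \<Longrightarrow> real n ^ (k - j) * q ^ max 1 ((k choose 2) - (j choose 2)) \<le> \<eta>" "0 \<le> \<eta>"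
  defines "l \<equiv> k choose 2"
  shows "(\<Sum>(xs, Q)\<in>lassos n k t. q ^ card (clique_edges (insert Q (set xs))))
    \<le> real n ^ k * q ^ l * (real k ^ 2 * real n ^ (k - 2) * q ^ (l - 1)) ^ t *
      (real k * real (k * Suc t) ^ k * \<eta>)"
proof -
  let ?L = "\<lambda>xs. {Q \<in> [{..<n}]\<^bsup>k\<^esup>. lasso k Q xs}"
  let ?V = "\<lambda>xs. \<Union>(set xs)"
  have fL: "finite (?L xs)" for xs by (simp add: finite_imp_finite_nsets)
  have "(\<Sum>(xs, Q)\<in>lassos n k t. q ^ card (clique_edges (insert Q (set xs))))
      = (\<Sum>xs\<in>tight_paths n k t. \<Sum>Q\<in>?L xs. q ^ card (clique_edges (insert Q (set xs))))"
    unfolding lassos_def using fL by (simp add: sum.Sigma)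
  also have "\<dots> \<le> (\<Sum>xs\<in>tight_paths n k t. q ^ card (clique_edges (set xs)) * (real k * real (k * Suc t) ^ k * \<eta>))"
  proof (rule sum_mono)
    fix xs assume xs: "xs \<in> tight_paths n k t"
    then have mem: "\<forall>P\<in>set xs. finite P \<and> card P = k" and len: "length xs = Suc t"
      using tight_path_members by (auto simp: tight_paths_def)
    have fV: "finite (?V xs)" using mem by auto
    have "card (?V xs) \<le> (\<Sum>P\<in>set xs. card P)"
      using card_Union_le_sum_card[of "set xs"] by simp
    also have "\<dots> = card (set xs) * k" using mem by simp
    also have "\<dots> \<le> k * Suc t" using card_length[of xs] len by (subst mult.commute) (intro mult_le_mono2, simp)
    finally have cV: "card (?V xs) \<le> k * Suc t" .
    let ?M = "\<lambda>j. {Q \<in> [{..<n}]\<^bsup>k\<^esup>. card (Q \<inter> ?V xs) = j}"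
    have fM: "finite (?M j)" for j by (simp add: finite_imp_finite_nsets)
    have "(\<Sum>Q\<in>?L xs. q ^ card (clique_edges (insert Q (set xs))))
        \<le> (\<Sum>Q\<in>?L xs. q ^ (card (clique_edges (set xs)) + max 1 (l - (card (Q \<inter> ?V xs) choose 2))))"
    proof (rule sum_mono)
      fix Q assume Q: "Q \<in> ?L xs"
      have "card (clique_edges (set xs)) + max 1 (l - (card (Q \<inter> ?V xs) choose 2)) \<le> card (clique_edges (insert Q (set xs)))"
        using card_clique_edges_insert_ge[of "set xs" Q k] mem Q by (auto simp: l_def nsets_def lasso_def max_def)
      then show "q ^ card (clique_edges (insert Q (set xs)))
          \<le> q ^ (card (clique_edges (set xs)) + max 1 (l - (card (Q \<inter> ?V xs) choose 2)))"
        using q by (intro power_decreasing) auto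
    qed
    also have "\<dots> \<le> (\<Sum>Q\<in>(\<Union>j\<in>{3..k}. ?M j). q ^ (card (clique_edges (set xs)) + max 1 (l - (card (Q \<inter> ?V xs) choose 2))))"
    proof (rule sum_mono2)
      show "finite (\<Union>j\<in>{3..k}. ?M j)" using fM by blast
      show "?L xs \<subseteq> (\<Union>j\<in>{3..k}. ?M j)"
        by (auto simp: lasso_def nsets_def intro!: card_mono)
    qed (use q in auto)
    also have "\<dots> = (\<Sum>j\<in>{3..k}. \<Sum>Q\<in>?M j. q ^ (card (clique_edges (set xs)) + max 1 (l - (card (Q \<inter> ?V xs) choose 2))))"
      using fM by (intro sum.UNION_disjoint) auto
    also have "\<dots> \<le> (\<Sum>j\<in>{3..k}. q ^ card (clique_edges (set xs)) * (real (k * Suc t) ^ k * \<eta>))"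
    proof (rule sum_mono)
      fix j assume j: "j \<in> {3..k}"
      have "(\<Sum>Q\<in>?M j. q ^ (card (clique_edges (set xs)) + max 1 (l - (card (Q \<inter> ?V xs) choose 2))))
          = real (card (?M j)) * (q ^ card (clique_edges (set xs)) * q ^ max 1 (l - (j choose 2)))"
        by (simp add: power_add)
      also have "\<dots> \<le> (real (k * Suc t) ^ k * real n ^ (k - j)) * (q ^ card (clique_edges (set xs)) * q ^ max 1 (l - (j choose 2)))"
      proof (intro mult_right_mono)
        have "card (?M j) \<le> card (?V xs) ^ j * n ^ (k - j)" by (rule card_nsets_meet[OF fV])
        also have "\<dots> \<le> (k * Suc t) ^ j * n ^ (k - j)" using cV by (intro mult_right_mono power_mono) auto
        also have "\<dots> \<le> (k * Suc t) ^ k * n ^ (k - j)" using j k by (intro mult_right_mono power_increasing) auto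
        finally have "real (card (?M j)) \<le> real ((k * Suc t) ^ k * n ^ (k - j))" by (rule of_nat_mono)
        then show "real (card (?M j)) \<le> real (k * Suc t) ^ k * real n ^ (k - j)" by simp
      qed (use q in auto)
      also have "\<dots> = q ^ card (clique_edges (set xs)) * (real (k * Suc t) ^ k * (real n ^ (k - j) * q ^ max 1 (l - (j choose 2))))"
        by (simp only: mult_ac)
      also have "\<dots> \<le> q ^ card (clique_edges (set xs)) * (real (k * Suc t) ^ k * \<eta>)"
        using q j \<eta>(1)[of j] unfolding l_def by (intro mult_left_mono) auto
      finally show "(\<Sum>Q\<in>?M j. q ^ (card (clique_edges (set xs)) + max 1 (l - (card (Q \<inter> ?V xs) choose 2))))
          \<le> q ^ card (clique_edges (set xs)) * (real (k * Suc t) ^ k * \<eta>)" .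
    qed
    also have "\<dots> = real (card {3..k}) * (q ^ card (clique_edges (set xs)) * (real (k * Suc t) ^ k * \<eta>))"
      by simp
    also have "\<dots> \<le> real k * (q ^ card (clique_edges (set xs)) * (real (k * Suc t) ^ k * \<eta>))"
      using q \<eta>(2) by (intro mult_right_mono) auto
    finally show "(\<Sum>Q\<in>?L xs. q ^ card (clique_edges (insert Q (set xs))))
        \<le> q ^ card (clique_edges (set xs)) * (real k * real (k * Suc t) ^ k * \<eta>)"
      by (simp only: mult_ac)
  qed
  also have "\<dots> = (\<Sum>xs\<in>tight_paths n k t. q ^ card (clique_edges (set xs))) * (real k * real (k * Suc t) ^ k * \<eta>)"
    by (simp only: sum_distrib_right)
  also have "\<dots> \<le> real n ^ k * q ^ l * (real k ^ 2 * real n ^ (k - 2) * q ^ (l - 1)) ^ t * (real k * real (k * Suc t) ^ k * \<eta>)"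
    unfolding l_def using \<eta>(2) by (intro mult_right_mono sum_tight_paths q k) auto
  finally show ?thesis .
qed

section \<open>Sparse Ramsey graphs\<close>

lemma clique_scale_tendsto: "(\<lambda>n. clique_scale k n) \<longlonglongrightarrow> 0"
  unfolding clique_scale_def
  by (rule tendsto_neg_powr) (auto simp: filterlim_real_sequentially field_simps)

text \<open>The exponents in \<open>clique_scale_power\<close> at \<open>k\<close> and at
  \<open>2\<close> coincide. By the second identity, attaching one more clique multiplies the bound
  for tight paths by a constant, at densities of order \<open>clique_scale k n\<close>.\<close>

lemma clique_scale_full:
  assumes "n \<ge> 1" "k \<ge> 2"
  shows "real n ^ k * clique_scale k n ^ (k choose 2) = real n ^ 2 * clique_scale k n"
    and "real n ^ (k - 2) * clique_scale k n ^ ((k choose 2) - 1) = 1"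
proof -
  let ?\<tau> = "clique_scale k n"
  have \<tau>: "?\<tau> > 0" using clique_scale_bounds[OF assms(1)] by simp
  have l: "k choose 2 \<ge> 1" using assms(2) by (simp add: Suc_le_eq zero_less_binomial)
  show 1: "real n ^ k * ?\<tau> ^ (k choose 2) = real n ^ 2 * ?\<tau>"
    using clique_scale_power[OF assms(1), of k k] clique_scale_power[OF assms(1), of 2 k]
    by (simp add: mult.commute)
  have "(real n ^ (k - 2) * ?\<tau> ^ ((k choose 2) - 1)) * (real n ^ 2 * ?\<tau>) = real n ^ (k - 2 + 2) * ?\<tau> ^ ((k choose 2) - 1 + 1)"
    by (simp add: power_add mult_ac power2_eq_square)
  also have "\<dots> = real n ^ 2 * ?\<tau>"
    using 1 assms(2) l by (simp only: le_add_diff_inverse2)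
  finally have "(real n ^ (k - 2) * ?\<tau> ^ ((k choose 2) - 1)) * (real n ^ 2 * ?\<tau>) = 1 * (real n ^ 2 * ?\<tau>)"
    by simp
  then show "real n ^ (k - 2) * ?\<tau> ^ ((k choose 2) - 1) = 1"
    using \<tau> assms(1) by (subst (asm) mult_right_cancel) auto
qed

text \<open>For \<open>j < k\<close> the exponent of \<open>n\<close> is
  \<open>- (j - 2) * (k - j) / (k + 1)\<close>, at most \<open>- 1 / (k + 1)\<close>. For
  \<open>j = k\<close> the single new edge contributes \<open>clique_scale k n\<close>
  itself.\<close>

lemma lasso_closing_factor:
  fixes M :: real
  assumes n: "n \<ge> 1" and M: "M \<ge> 1" and j: "3 \<le> j" "j \<le> k"
  defines "q \<equiv> M * clique_scale k n" and "l \<equiv> k choose 2"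
  shows "real n ^ (k - j) * q ^ max 1 (l - (j choose 2)) \<le> M ^ l * real n powr (- 1 / (real k + 1))"
proof -
  let ?\<tau> = "clique_scale k n"
  have \<tau>: "?\<tau> > 0" "?\<tau> \<le> 1" using clique_scale_bounds[OF n] by auto
  have l: "l \<ge> 1" using j unfolding l_def by (simp add: Suc_le_eq zero_less_binomial)
  define x where "x = max 1 (l - (j choose 2))"
  have xl: "x \<le> l" using l by (simp add: x_def)
  have "real n ^ (k - j) * ?\<tau> ^ x \<le> real n powr (- 1 / (real k + 1))"
  proof (cases "j = k")
    case True
    then have "real n ^ (k - j) * ?\<tau> ^ x = real n powr (- 2 / (real k + 1))"
      by (simp add: x_def l_def clique_scale_def)
    also have "\<dots> \<le> real n powr (- 1 / (real k + 1))"
      using n by (intro powr_mono divide_right_mono) auto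
    finally show ?thesis .
  next
    case False
    then have jk: "j < k" using j by simp
    have "real (j choose 2) < real (k choose 2)"
      using jk j unfolding real_choose_two
      by (intro divide_strict_right_mono mult_strict_mono) auto
    then have jl: "j choose 2 < l" by (simp add: l_def)
    then have x: "x = l - (j choose 2)" by (simp add: x_def)
    have quot: "A = real n powr (c - b)" if "A * real n powr b = real n powr c" for A b c
      using that n by (simp add: powr_diff eq_divide_eq)
    have "(real n ^ (k - j) * ?\<tau> ^ x) * (real n ^ j * ?\<tau> ^ (j choose 2)) = real n ^ (k - j + j) * ?\<tau> ^ (x + (j choose 2))"
      by (simp only: power_add mult_ac)
    also have "\<dots> = real n ^ k * ?\<tau> ^ (k choose 2)"
      using jk jl x by (simp add: l_def)
    finally have "(real n ^ (k - j) * ?\<tau> ^ x) * real n powr (real j * (real k + 2 - real j) / (real k + 1))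
        = real n powr (real k * (real k + 2 - real k) / (real k + 1))"
      unfolding clique_scale_power[OF n] .
    then have "real n ^ (k - j) * ?\<tau> ^ x = real n powr (real k * (real k + 2 - real k) / (real k + 1)
        - real j * (real k + 2 - real j) / (real k + 1))"
      by (rule quot)
    also have "\<dots> \<le> real n powr (- 1 / (real k + 1))"
    proof (rule powr_mono)
      have "1 * 1 \<le> (real j - 2) * (real k - real j)"
        using j jk by (intro mult_mono) auto
      then have "real k * (real k + 2 - real k) - real j * (real k + 2 - real j) \<le> - 1"
        by (simp add: algebra_simps)
      then show "real k * (real k + 2 - real k) / (real k + 1) - real j * (real k + 2 - real j) / (real k + 1)
          \<le> - 1 / (real k + 1)"
        unfolding diff_divide_distrib[symmetric] by (intro divide_right_mono) auto
    qed (use n in auto)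
    finally show ?thesis .
  qed
  moreover have "M ^ x \<le> M ^ l" using M xl by (intro power_increasing)
  ultimately have "M ^ x * (real n ^ (k - j) * ?\<tau> ^ x) \<le> M ^ l * real n powr (- 1 / (real k + 1))"
    using M \<tau> by (intro mult_mono) auto
  then show ?thesis by (simp add: q_def x_def power_mult_distrib mult_ac)
qed

text \<open>Each attached clique costs a constant factor and the closing clique gains a power of
  \<open>n\<close>. The constants do not depend on \<open>n\<close>, so the number of cliques enters
  only through \<open>B ^ g\<close>.\<close>

lemma expected_lassos:
  fixes M :: real
  assumes k: "k \<ge> 3" and M: "M \<ge> 1"
  shows "\<exists>K>0. \<exists>B\<ge>2. \<forall>n\<ge>1. M * clique_scale k n \<le> 1 \<longrightarrow> (\<forall>g.
    (\<Sum>t<g. \<Sum>(xs, Q)\<in>lassos n k t. (M * clique_scale k n) ^ card (clique_edges (insert Q (set xs))))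
      \<le> K * B ^ g * real n powr (- 1 / (real k + 1)) * (clique_scale k n * real n ^ 2))"
proof -
  define l where "l = k choose 2"
  have l: "l \<ge> 1" using k unfolding l_def by (simp add: Suc_le_eq zero_less_binomial)
  define b where "b = real k ^ 2 * M ^ (l - 1)"
  define B where "B = b * 2 ^ k"
  define K where "K = M ^ l * (real k * real k ^ k * M ^ l)"
  have b1: "b \<ge> 1"
  proof -
    have "1 * 1 \<le> real k ^ 2 * M ^ (l - 1)"
      using k M by (intro mult_mono one_le_power) auto
    then show ?thesis by (simp add: b_def)
  qed
  have "1 * 2 ^ 1 \<le> b * 2 ^ k"
    using b1 k by (intro mult_mono power_increasing) auto
  then have B: "B \<ge> 2" by (simp add: B_def)
  have K: "K > 0" using M k by (auto simp: K_def)
  show ?thesis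
  proof (rule exI[of _ K], intro conjI K, rule exI[of _ B], intro conjI B allI impI)
    fix n g :: nat assume n: "n \<ge> 1" and q1: "M * clique_scale k n \<le> 1"
    let ?\<tau> = "clique_scale k n" and ?\<eta> = "real n powr (- 1 / (real k + 1))"
    have \<tau>: "?\<tau> > 0" using clique_scale_bounds[OF n] by auto
    let ?q = "M * ?\<tau>"
    have q: "0 \<le> ?q" using M \<tau> by simp
    have "(\<Sum>(xs, Q)\<in>lassos n k t. ?q ^ card (clique_edges (insert Q (set xs)))) \<le> K * B ^ t * ?\<eta> * (?\<tau> * real n ^ 2)" for t
    proof -
      have "(\<Sum>(xs, Q)\<in>lassos n k t. ?q ^ card (clique_edges (insert Q (set xs))))
          \<le> real n ^ k * ?q ^ l * (real k ^ 2 * real n ^ (k - 2) * ?q ^ (l - 1)) ^ t *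
            (real k * real (k * Suc t) ^ k * (M ^ l * ?\<eta>))"
        unfolding l_def using k M
        by (intro sum_lassos q q1 lasso_closing_factor n) auto
      also have "real n ^ k * ?q ^ l = M ^ l * (?\<tau> * real n ^ 2)"
        using clique_scale_full(1)[OF n, of k] k by (simp add: power_mult_distrib l_def mult_ac)
      also have "real k ^ 2 * real n ^ (k - 2) * ?q ^ (l - 1) = real k ^ 2 * M ^ (l - 1) * (real n ^ (k - 2) * ?\<tau> ^ (l - 1))"
        by (simp add: power_mult_distrib mult_ac)
      also have "\<dots> = b"
        using clique_scale_full(2)[OF n, of k] k by (simp add: l_def b_def)
      \<comment> \<open>The factor \<open>Suc t ^ k\<close> is at most \<open>(2 ^ k) ^ t\<close>
        and is absorbed into \<open>B ^ t\<close>.\<close>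
      also have "M ^ l * (?\<tau> * real n ^ 2) * b ^ t * (real k * real (k * Suc t) ^ k * (M ^ l * ?\<eta>))
          \<le> M ^ l * (?\<tau> * real n ^ 2) * b ^ t * (real k * (real k ^ k * (2 ^ k) ^ t) * (M ^ l * ?\<eta>))"
      proof -
        have "Suc t \<le> 2 ^ t" by (induction t) auto
        then have "real (Suc t) \<le> 2 ^ t"
          by (metis of_nat_le_iff of_nat_numeral of_nat_power)
        then have "real (Suc t) ^ k \<le> (2 ^ t) ^ k" by (intro power_mono) auto
        then have "real (k * Suc t) ^ k \<le> real k ^ k * (2 ^ k) ^ t"
          unfolding of_nat_mult power_mult_distrib
          by (intro mult_left_mono) (auto simp: power_mult[symmetric] mult.commute)
        then show ?thesis
          using M \<tau> b1 by (intro mult_left_mono mult_right_mono) auto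
      qed
      also have "\<dots> = K * B ^ t * ?\<eta> * (?\<tau> * real n ^ 2)"
        by (simp add: K_def B_def power_mult_distrib mult_ac)
      finally show ?thesis .
    qed
    then have "(\<Sum>t<g. \<Sum>(xs, Q)\<in>lassos n k t. ?q ^ card (clique_edges (insert Q (set xs))))
        \<le> (\<Sum>t<g. K * B ^ t * ?\<eta> * (?\<tau> * real n ^ 2))"
      by (intro sum_mono) auto
    also have "\<dots> = K * (\<Sum>t<g. B ^ t) * ?\<eta> * (?\<tau> * real n ^ 2)"
      by (simp add: sum_distrib_left sum_distrib_right)
    also have "(\<Sum>t<g. B ^ t) \<le> B ^ g"
    proof (induction g)
      case (Suc g)
      have "2 * B ^ g \<le> B * B ^ g" using B by (intro mult_right_mono) auto
      then show ?case using Suc by simp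
    qed simp
    finally show "(\<Sum>t<g. \<Sum>(xs, Q)\<in>lassos n k t. ?q ^ card (clique_edges (insert Q (set xs))))
        \<le> K * B ^ g * ?\<eta> * (?\<tau> * real n ^ 2)"
      using K \<tau> by (simp add: mult_left_mono mult_right_mono)
  qed
qed

section \<open>The Ramsey property under deletion of edges\<close>

definition clique_colourable :: "nat \<Rightarrow> nat \<Rightarrow> nat \<Rightarrow> nat set set \<Rightarrow> bool"
  where "clique_colourable n k r G \<longleftrightarrow> (\<exists>col. (\<forall>e\<in>G. col e < r) \<and>
    (\<forall>A\<in>cliques n k. A \<subseteq> G \<longrightarrow> \<not> (\<exists>i<r. \<forall>e\<in>A. col e = i)))"

text \<open>A bad \<open>H\<close> contains the fingerprints of the colour classes of
  \<open>G\<close>, and it meets the pairs outside all their containers only within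
  \<open>H - G\<close>. \<open>union_bound_fingerprints\<close> bounds the probability of
  this.\<close>

lemma robust_ramsey:
  assumes k: "k \<ge> 2" and r: "r \<ge> 1"
  shows "\<exists>M\<ge>1. \<exists>\<kappa>>0. \<exists>n0. \<forall>n\<ge>n0. M * clique_scale k n \<le> 1 \<longrightarrow>
    (\<Sum>H | H \<subseteq> all_edges n \<and>
        (\<exists>G\<subseteq>H. real (card (H - G)) \<le> \<kappa> * (clique_scale k n * real n ^ 2) \<and> clique_colourable n k r G).
      binomial_weight (M * clique_scale k n) (all_edges n) H) \<le> 1 / 2"
proof -
  obtain \<epsilon> \<delta> n1 where \<epsilon>: "\<epsilon> > 0" and \<delta>: "\<delta> > 0" and supersat: "\<forall>n\<ge>n1. \<forall>C :: nat \<Rightarrow> nat set set.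
      (\<forall>i<r. real (card {A \<in> cliques n k. A \<subseteq> C i}) \<le> \<epsilon> * real n ^ k) \<longrightarrow>
      real (card (all_edges n - (\<Union>i<r. C i))) \<ge> \<delta> * real n ^ 2"
    using ramsey_supersaturation[OF k, of r] by (elim exE conjE) (rule that)
  obtain Q where Q: "Q > 0" and cont: "\<And>n. n \<ge> 1 \<Longrightarrow>
      containers {G. G \<subseteq> all_edges n \<and> (\<forall>A \<in> cliques n k. \<not> A \<subseteq> G)}
      (Q * (clique_scale k n * real n ^ 2))
      (\<lambda>C. C \<subseteq> all_edges n \<and> real (card {A \<in> cliques n k. A \<subseteq> C}) \<le> \<epsilon> * real n ^ k)"
    using clique_containers[OF k \<epsilon>] by blast
  \<comment> \<open>Keeps \<open>r * q * x * card E\<close> below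
    \<open>q * \<delta> * n ^ 2 / 8\<close>, a quarter of the gain
    \<open>q * \<delta> * n ^ 2 / 2\<close> in the exponent.\<close>
  define x where "x = min 1 (\<delta> / (8 * real r))"
  have x: "0 < x" "x \<le> 1" "real r * x \<le> \<delta> / 8"
    using \<delta> r by (auto simp: x_def min_def field_simps)
  have L: "ln (1 / x) \<ge> 0" using x by simp
  \<comment> \<open>The \<open>\<kappa>\<close> below lets the deleted edges cost another quarter of
    the gain. The remaining half, \<open>M * \<delta> / 4\<close> per unit of
    \<open>clique_scale k n * n ^ 2\<close>, must pay for the fingerprints and leave 1.\<close>
  define M where "M = max 1 (4 * (1 + real r * Q * ln (1 / x)) / \<delta>)"
  have M: "M \<ge> 1" by (simp add: M_def)
  have "4 * (1 + real r * Q * ln (1 / x)) / \<delta> \<le> M" by (simp add: M_def)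
  then have M\<delta>: "1 + real r * Q * ln (1 / x) \<le> M * \<delta> / 4" using \<delta> by (simp add: field_simps)
  define \<kappa> where "\<kappa> = \<delta> * M / 8"
  have \<kappa>: "\<kappa> > 0" using \<delta> M by (simp add: \<kappa>_def)
  show ?thesis
  proof (rule exI[of _ M], intro conjI M, rule exI[of _ \<kappa>], intro conjI \<kappa>,
      rule exI[of _ "max 1 n1"], intro allI impI)
    fix n assume n: "max 1 n1 \<le> n" and q1: "M * clique_scale k n \<le> 1"
    have n': "n \<ge> 1" "n \<ge> n1" using n by auto
    let ?\<tau> = "clique_scale k n" and ?E = "all_edges n"
    let ?N = "?\<tau> * real n ^ 2"
    let ?q = "M * ?\<tau>"
    note \<tau> = clique_scale_bounds[OF n'(1), of k]
    have q0: "0 \<le> ?q" using M \<tau> by simp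
    have fE: "finite ?E" by (simp add: finite_imp_finite_nsets)
    obtain S F where SF: "container_maps {G. G \<subseteq> ?E \<and> (\<forall>A \<in> cliques n k. \<not> A \<subseteq> G)} (Q * ?N)
        (\<lambda>C. C \<subseteq> ?E \<and> real (card {A \<in> cliques n k. A \<subseteq> C}) \<le> \<epsilon> * real n ^ k) S F"
      using cont[OF n'(1)] by (rule containersE)
    define D where "D T = ?E - (\<Union>i<r. F (T i))" for T :: "nat \<Rightarrow> nat set set"
    \<comment> \<open>All conditions concern the tuple of fingerprints alone. As \<open>F\<close>
      takes the same value at a class and at its fingerprint, \<open>D\<close> depends only on the
      tuple, and the union bound runs over tuples instead of colourings.\<close>
    define \<T> where "\<T> = {T \<in> PiE {..<r} (\<lambda>_. {A. A \<subseteq> ?E \<and> real (card A) \<le> Q * ?N}).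
      (\<forall>i<r. \<forall>j<r. i \<noteq> j \<longrightarrow> T i \<inter> T j = {}) \<and> (\<forall>i<r. T i \<subseteq> F (T i)) \<and>
      (\<forall>i<r. real (card {A \<in> cliques n k. A \<subseteq> F (T i)}) \<le> \<epsilon> * real n ^ k)}"
    let ?Bad = "{H. H \<subseteq> ?E \<and> (\<exists>G\<subseteq>H. real (card (H - G)) \<le> \<kappa> * ?N \<and> clique_colourable n k r G)}"
    have "(\<Sum>H\<in>?Bad. binomial_weight ?q ?E H)
      \<le> exp (\<kappa> * ?N * ln 2 - ?q * (\<delta> * real n ^ 2) / 2
          + real r * (Q * ?N * ln (1 / x) + ?q * x * real (card ?E)))"
    proof (rule union_bound_fingerprints[OF fE q0 q1 x(1,2), where \<T> = \<T> and D = D])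
      fix H assume "H \<in> ?Bad"
      then obtain G where H: "H \<subseteq> ?E" and G: "G \<subseteq> H" "real (card (H - G)) \<le> \<kappa> * ?N"
        and colourable: "clique_colourable n k r G"
        by blast
      obtain col where "\<forall>e\<in>G. col e < r"
          "\<forall>A\<in>cliques n k. A \<subseteq> G \<longrightarrow> \<not> (\<exists>i<r. \<forall>e\<in>A. col e = i)"
        using colourable unfolding clique_colourable_def by (elim exE conjE) (rule that)
      then have col: "\<And>e. e \<in> G \<Longrightarrow> col e < r"
          "\<And>A i. A \<in> cliques n k \<Longrightarrow> A \<subseteq> G \<Longrightarrow> i < r \<Longrightarrow> \<not> (\<forall>e\<in>A. col e = i)"
        by auto
      define Gi where "Gi i = {e \<in> G. col e = i}" for i
      have Gi: "Gi i \<in> {G. G \<subseteq> ?E \<and> (\<forall>A \<in> cliques n k. \<not> A \<subseteq> G)}" if "i < r" for i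
        using col(2)[OF _ _ that] G H by (fastforce simp: Gi_def)
      have SGi: "S (Gi i) \<subseteq> Gi i" "real (card (S (Gi i))) \<le> Q * ?N" "F (S (Gi i)) = F (Gi i)" for i
        using container_mapsD(1,3)[OF SF, of "Gi i"] container_mapsD(5)[OF SF, of "Gi i" "S (Gi i)"] by auto
      define T where "T = (\<lambda>i\<in>{..<r}. S (Gi i))"
      have T: "T i = S (Gi i)" if "i < r" for i using that by (simp add: T_def)
      have GE: "Gi i \<subseteq> ?E" for i using G H by (auto simp: Gi_def)
      have "T \<in> \<T>"
        unfolding \<T>_def
      proof (intro CollectI conjI allI impI)
        show "T \<in> PiE {..<r} (\<lambda>_. {A. A \<subseteq> ?E \<and> real (card A) \<le> Q * ?N})"
          unfolding T_def restrict_PiE_iff using SGi GE by blast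
        show "T i \<inter> T j = {}" if "i < r" "j < r" "i \<noteq> j" for i j
          using SGi(1)[of i] SGi(1)[of j] that by (auto simp: T Gi_def)
        show "T i \<subseteq> F (T i)" "real (card {A \<in> cliques n k. A \<subseteq> F (T i)}) \<le> \<epsilon> * real n ^ k"
          if "i < r" for i
          using container_mapsD(6,7)[OF SF Gi[OF that]] SGi[of i] that by (auto simp: T)
      qed
      moreover have "(\<Union>i<r. T i) \<subseteq> H"
        using SGi(1) G by (fastforce simp: T Gi_def)
      moreover have "real (card (H \<inter> D T)) \<le> \<kappa> * ?N"
      proof -
        have "G \<subseteq> (\<Union>i<r. F (T i))"
        proof
          fix e assume e: "e \<in> G"
          have "e \<in> F (Gi (col e))"
            using container_mapsD(6)[OF SF Gi[OF col(1)[OF e]]] e by (auto simp: Gi_def)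
          then show "e \<in> (\<Union>i<r. F (T i))"
            using col(1)[OF e] SGi(3) by (auto simp: T)
        qed
        then have "H \<inter> D T \<subseteq> H - G" by (auto simp: D_def)
        then have "card (H \<inter> D T) \<le> card (H - G)"
          using H fE by (intro card_mono) (auto intro: finite_subset)
        then show ?thesis using G(2) by linarith
      qed
      ultimately show "\<exists>T\<in>\<T>. (\<Union>i<r. T i) \<subseteq> H \<and> real (card (H \<inter> D T)) \<le> \<kappa> * ?N" by blast
    next
      show "\<delta> * real n ^ 2 \<le> real (card (D T))" if "T \<in> \<T>" for T
        unfolding D_def using that by (intro supersat[rule_format] n') (auto simp: \<T>_def)
      show "(\<Union>i<r. T i) \<inter> D T = {}" if "T \<in> \<T>" for T
      proof -
        have "\<forall>i<r. T i \<subseteq> F (T i)" using that by (simp add: \<T>_def)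
        then show ?thesis unfolding D_def by blast
      qed
    qed (auto simp: \<T>_def D_def)
    also have "\<dots> \<le> exp (- ?N)"
    proof -
      have N: "?N \<ge> 1" using \<tau> by simp
      have "\<kappa> * ?N \<ge> 0" using \<kappa> N by (intro mult_nonneg_nonneg[of \<kappa> ?N]) linarith+
      then have "\<kappa> * ?N * ln 2 \<le> \<kappa> * ?N * 1"
        using ln_le_minus_one[of 2] by (intro mult_left_mono) auto
      moreover have "real (card ?E) \<le> real n ^ 2"
        using choose_le_power[of n 2] by (simp flip: of_nat_power)
      then have "(real r * x) * (?q * real (card ?E)) \<le> (\<delta> / 8) * (?q * real n ^ 2)"
        using \<delta> by (intro mult_mono[OF x(3) mult_left_mono[OF _ q0]] mult_nonneg_nonneg[OF q0]) auto
      moreover have "(1 + real r * Q * ln (1 / x)) * ?N \<le> (M * \<delta> / 4) * ?N"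
        using M\<delta> N by (intro mult_right_mono) auto
      ultimately show ?thesis
        by (simp add: \<kappa>_def algebra_simps)
    qed
    also have "\<dots> \<le> exp (- 1)" using \<tau> by simp
    also have "\<dots> \<le> 1 / 2"
      using exp_ge_add_one_self[of 1] by (simp add: exp_minus field_simps)
    finally show "(\<Sum>H\<in>?Bad. binomial_weight ?q ?E H) \<le> 1 / 2" .
  qed
qed

text \<open>With positive probability \<open>H\<close> is not bad and has fewer lassos than the
  number of deletions that the Ramsey property tolerates. Deleting one edge from each lasso gives
  \<open>G\<close>.\<close>

lemma sparse_ramsey_graph:
  assumes k: "k \<ge> 3" and r: "r \<ge> 1"
  shows "\<exists>c>0. \<exists>n0. \<forall>n\<ge>n0. \<exists>G\<subseteq>all_edges n. \<not> clique_colourable n k r G \<and>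
    (\<forall>Q xs. set (Q # xs) \<subseteq> [{..<n}]\<^bsup>k\<^esup> \<longrightarrow> clique_edges (set (Q # xs)) \<subseteq> G \<longrightarrow>
      real (length (Q # xs)) \<le> c * log 2 (real n) \<longrightarrow> \<not> lasso k Q xs)"
proof -
  have k2: "k \<ge> 2" using k by simp
  obtain M \<kappa> n1 where M: "M \<ge> 1" and \<kappa>: "\<kappa> > 0" and robust: "\<forall>n\<ge>n1. M * clique_scale k n \<le> 1 \<longrightarrow>
    (\<Sum>H | H \<subseteq> all_edges n \<and>
        (\<exists>G\<subseteq>H. real (card (H - G)) \<le> \<kappa> * (clique_scale k n * real n ^ 2) \<and> clique_colourable n k r G).
      binomial_weight (M * clique_scale k n) (all_edges n) H) \<le> 1 / 2"
    using robust_ramsey[OF k2 r] by (elim exE conjE) (rule that)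
  obtain K B where K: "K > 0" and B: "B \<ge> 2" and expect: "\<forall>n\<ge>1. M * clique_scale k n \<le> 1 \<longrightarrow> (\<forall>g.
    (\<Sum>t<g. \<Sum>(xs, Q)\<in>lassos n k t. (M * clique_scale k n) ^ card (clique_edges (insert Q (set xs))))
      \<le> K * B ^ g * real n powr (- 1 / (real k + 1)) * (clique_scale k n * real n ^ 2))"
    using expected_lassos[OF k M] by (elim exE conjE) (rule that)
  define \<eta> where "\<eta> = 1 / (real k + 1)"
  have \<eta>: "\<eta> > 0" by (simp add: \<eta>_def)
  have logB: "log 2 B > 0" using B by simp
  \<comment> \<open>Makes \<open>B ^ g\<close> at most \<open>n powr (\<eta> / 2)\<close>, so half
    of the gain \<open>n powr (- \<eta>)\<close> survives.\<close>
  define c where "c = \<eta> / (2 * log 2 B)"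
  have c: "c > 0" using \<eta> logB by (simp add: c_def)
  have "(\<lambda>n. M * clique_scale k n) \<longlonglongrightarrow> M * 0"
    by (intro tendsto_intros clique_scale_tendsto)
  then have "\<forall>\<^sub>F n in sequentially. M * clique_scale k n < 1"
    by (rule order_tendstoD) simp
  moreover have "(\<lambda>n. K / \<kappa> * real n powr (- \<eta> / 2)) \<longlonglongrightarrow> K / \<kappa> * 0"
    using \<eta> by (intro tendsto_mult tendsto_const tendsto_neg_powr filterlim_real_sequentially) auto
  then have "\<forall>\<^sub>F n in sequentially. K / \<kappa> * real n powr (- \<eta> / 2) < 1 / 2"
    by (rule order_tendstoD) simp
  ultimately have "\<forall>\<^sub>F n in sequentially. M * clique_scale k n < 1 \<and> K / \<kappa> * real n powr (- \<eta> / 2) < 1 / 2"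
    by eventually_elim auto
  then obtain n2 where n2: "\<And>n. n \<ge> n2 \<Longrightarrow> M * clique_scale k n < 1 \<and> K / \<kappa> * real n powr (- \<eta> / 2) < 1 / 2"
    unfolding eventually_sequentially by blast
  show ?thesis
  proof (rule exI[of _ c], intro conjI c, rule exI[of _ "max 1 (max n1 n2)"], intro allI impI)
    fix n assume "max 1 (max n1 n2) \<le> n"
    then have n: "n \<ge> 1" "n \<ge> n1" "n \<ge> n2" by auto
    let ?E = "all_edges n" and ?q = "M * clique_scale k n" and ?N = "clique_scale k n * real n ^ 2"
    have fE: "finite ?E" by (simp add: finite_imp_finite_nsets)
    have q: "0 \<le> ?q" "?q \<le> 1" using M clique_scale_bounds[OF n(1), of k] n2[OF n(3)] by auto
    have N: "?N \<ge> 1" using clique_scale_bounds[OF n(1), of k] by simp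
    define a where "a = \<kappa> * ?N"
    have a: "a > 0" using \<kappa> N by (simp add: a_def)
    let ?w = "binomial_weight ?q ?E"
    have w: "?w H \<ge> 0" for H using q by (rule binomial_weight_nonneg)
    \<comment> \<open>A lasso whose path has \<open>Suc t\<close> cliques has \<open>t + 2\<close>
      cliques in all, so the indices \<open>t < g\<close> cover every length allowed.\<close>
    define g where "g = nat \<lfloor>c * log 2 (real n)\<rfloor>"
    have log0: "c * log 2 (real n) \<ge> 0" using c n by simp
    define L where "L = (SIGMA t:{..<g}. lassos n k t)"
    define ce where "ce = (\<lambda>(t :: nat, xs, Q :: nat set). clique_edges (insert Q (set xs)))"
    have fL: "finite L" by (simp add: L_def)
    have ceE: "ce y \<subseteq> ?E" "ce y \<noteq> {}" if "y \<in> L" for y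
      using that by (fastforce simp: L_def ce_def lassos_def tight_paths_def clique_edges_def nsets_def,
          auto simp: L_def ce_def lassos_def lasso_def clique_edges_def)
    define X where "X H = card {y\<in>L. ce y \<subseteq> H}" for H
    define Bad where "Bad = {H. H \<subseteq> ?E \<and> (\<exists>G\<subseteq>H. real (card (H - G)) \<le> a \<and> clique_colourable n k r G)}"
    have "(\<Sum>H\<in>Pow ?E. ?w H * real (X H)) = (\<Sum>H\<in>Pow ?E. \<Sum>y\<in>L. ?w H * (if ce y \<subseteq> H then 1 else 0))"
      unfolding X_def using fL by (simp add: sum_distrib_left[symmetric] sum.If_cases Int_def)
    also have "\<dots> = (\<Sum>y\<in>L. ?q ^ card (ce y))"
      using ceE fE by (subst sum.swap) (simp add: sum_binomial_weight_supersets)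
    also have "\<dots> = (\<Sum>t<g. \<Sum>(xs, Q)\<in>lassos n k t. ?q ^ card (clique_edges (insert Q (set xs))))"
    proof -
      have "(\<Sum>t<g. \<Sum>y\<in>lassos n k t. ?q ^ card (ce (t, y))) = (\<Sum>(t, y)\<in>L. ?q ^ card (ce (t, y)))"
        unfolding L_def by (rule sum.Sigma) auto
      then show ?thesis by (simp add: ce_def case_prod_unfold)
    qed
    also have "\<dots> \<le> K * B ^ g * real n powr (- 1 / (real k + 1)) * ?N"
      by (rule expect[rule_format, OF n(1) q(2)])
    also have "\<dots> \<le> K * real n powr (\<eta> / 2) * real n powr (- 1 / (real k + 1)) * ?N"
    proof -
      have "B ^ g = B powr real g" using B by (simp add: powr_realpow)
      also have "\<dots> \<le> B powr (c * log 2 (real n))"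
        using B log0 by (intro powr_mono) (auto simp: g_def)
      also have "\<dots> = (2 powr (log 2 B)) powr (c * log 2 (real n))"
        using B by simp
      also have "\<dots> = (2 powr (log 2 (real n))) powr (\<eta> / 2)"
        using logB unfolding powr_powr by (simp add: c_def field_simps)
      also have "\<dots> = real n powr (\<eta> / 2)" using n by simp
      finally show ?thesis using K N by (intro mult_right_mono mult_left_mono) auto
    qed
    also have "\<dots> = K * real n powr (- \<eta> / 2) * ?N"
    proof -
      have "real n powr (\<eta> / 2) * real n powr (- 1 / (real k + 1)) = real n powr (- \<eta> / 2)"
      proof -
        have "- 1 / (real k + 1) = - \<eta>" by (simp add: \<eta>_def)
        then show ?thesis by (simp flip: powr_add)
      qed
      then show ?thesis by (simp add: mult.assoc)
    qed
    also have "\<dots> = a * (K / \<kappa> * real n powr (- \<eta> / 2))"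
      using \<kappa> by (simp add: a_def)
    also have "\<dots> < a * (1 / 2)"
      using n2[OF n(3)] a by (intro mult_strict_left_mono) auto
    finally have EX: "(\<Sum>H\<in>Pow ?E. ?w H * real (X H)) < a / 2" by simp
    \<comment> \<open>\<open>Bad\<close> has probability at most \<open>1 / 2\<close>, and by
      Markov's inequality \<open>X H \<ge> a\<close> has probability below
      \<open>1 / 2\<close>.\<close>
    have "\<exists>H\<in>Pow ?E. H \<notin> Bad \<and> real (X H) < a"
    proof (rule ccontr)
      assume "\<not> (\<exists>H\<in>Pow ?E. H \<notin> Bad \<and> real (X H) < a)"
      then have "?w H \<le> (if H \<in> Bad then ?w H else 0) + ?w H * real (X H) / a" if "H \<in> Pow ?E" for H
        using that w[of H] a mult_left_mono[of a "real (X H)" "?w H"] by (auto simp: field_simps)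
      then have "(\<Sum>H\<in>Pow ?E. ?w H) \<le> (\<Sum>H\<in>Pow ?E. (if H \<in> Bad then ?w H else 0) + ?w H * real (X H) / a)"
        by (intro sum_mono) auto
      also have "\<dots> = (\<Sum>H\<in>Bad. ?w H) + (\<Sum>H\<in>Pow ?E. ?w H * real (X H)) / a"
      proof -
        have "Pow ?E \<inter> {H. H \<in> Bad} = Bad" by (auto simp: Bad_def)
        then show ?thesis using fE by (simp add: sum.distrib sum.If_cases sum_divide_distrib)
      qed
      also have "\<dots> < 1 / 2 + 1 / 2"
        using robust[rule_format, OF n(2) q(2)] EX a unfolding Bad_def a_def
        by (intro add_le_less_mono) (auto simp: field_simps)
      finally show False using sum_binomial_weight[OF fE] by simp
    qed
    then obtain H where H: "H \<subseteq> ?E" "H \<notin> Bad" "real (X H) < a" by auto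
    \<comment> \<open>One edge from each lasso contained in \<open>H\<close>. There are fewer than
      \<open>a\<close> of them, and \<open>H\<close> is not in \<open>Bad\<close>, so
      \<open>H - T\<close> is not colourable.\<close>
    define T where "T = (\<lambda>y. SOME e. e \<in> ce y) ` {y\<in>L. ce y \<subseteq> H}"
    have pick: "(SOME e. e \<in> ce y) \<in> ce y" if "y \<in> L" for y
      using ceE(2)[OF that] by (meson ex_in_conv someI_ex)
    have "card T \<le> X H" unfolding T_def X_def using fL by (intro card_image_le) auto
    moreover have "finite T" unfolding T_def using fL by auto
    then have "card (H - (H - T)) \<le> card T" by (intro card_mono) auto
    ultimately have cT: "real (card (H - (H - T))) \<le> a" using H(3) by linarith
    show "\<exists>G\<subseteq>?E. \<not> clique_colourable n k r G \<and>
      (\<forall>Q xs. set (Q # xs) \<subseteq> [{..<n}]\<^bsup>k\<^esup> \<longrightarrow> clique_edges (set (Q # xs)) \<subseteq> G \<longrightarrow>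
        real (length (Q # xs)) \<le> c * log 2 (real n) \<longrightarrow> \<not> lasso k Q xs)"
    proof (intro exI[of _ "H - T"] conjI allI impI notI)
      show "H - T \<subseteq> ?E" using H by auto
      show False if "clique_colourable n k r (H - T)"
        using that H(1,2) cT unfolding Bad_def by blast
      fix Q xs
      assume Qxs: "set (Q # xs) \<subseteq> [{..<n}]\<^bsup>k\<^esup>" "clique_edges (set (Q # xs)) \<subseteq> H - T"
        "real (length (Q # xs)) \<le> c * log 2 (real n)" and lasso: "lasso k Q xs"
      have "xs \<noteq> []" using lasso by (auto simp: lasso_def)
      then obtain t where t: "length xs = Suc t" by (cases xs) auto
      have "int (length (Q # xs)) \<le> \<lfloor>c * log 2 (real n)\<rfloor>" using Qxs(3) by (simp add: le_floor_iff)
      then have "t < g" using t by (simp add: g_def)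
      then have y: "(t, xs, Q) \<in> L"
        using Qxs(1) t lasso by (auto simp: L_def lassos_def tight_paths_def lasso_def nsets_def)
      have sub: "ce (t, xs, Q) \<subseteq> H - T" using Qxs(2) by (simp add: ce_def)
      then have "(SOME e. e \<in> ce (t, xs, Q)) \<in> T" using y unfolding T_def by blast
      then show False using pick[OF y] sub by blast
    qed
  qed
qed

theorem corollary1p5:
  fixes k r :: nat
  assumes "k \<ge> 3" and "r \<ge> 2"
  shows "\<exists>(c::real) (n0::nat). c > 0 \<and>
    (\<forall>n\<ge>n0. \<exists>H :: nat hypergraph.
       graph H \<and> card (verts H) = n \<and>
       ramsey_arrow H k r \<and>
       girth_at_least (k choose 2) (clique_hypergraph H k) (c * log 2 (real n)))"
proof -
  have r: "r \<ge> 1" using assms(2) by simp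
  obtain c n0 where c: "c > 0" and sparse: "\<forall>n\<ge>n0. \<exists>G\<subseteq>all_edges n. \<not> clique_colourable n k r G \<and>
    (\<forall>Q xs. set (Q # xs) \<subseteq> [{..<n}]\<^bsup>k\<^esup> \<longrightarrow> clique_edges (set (Q # xs)) \<subseteq> G \<longrightarrow>
      real (length (Q # xs)) \<le> c * log 2 (real n) \<longrightarrow> \<not> lasso k Q xs)"
    using sparse_ramsey_graph[OF assms(1) r] by (elim exE conjE) (rule that)
  show ?thesis
  proof (rule exI[of _ c], rule exI[of _ n0], intro conjI c allI impI)
    fix n assume "n \<ge> n0"
    from sparse[rule_format, OF this]
    obtain G where G: "G \<subseteq> all_edges n" "\<not> clique_colourable n k r G"
      and free: "\<forall>Q xs. set (Q # xs) \<subseteq> [{..<n}]\<^bsup>k\<^esup> \<longrightarrow> clique_edges (set (Q # xs)) \<subseteq> G \<longrightarrow>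
        real (length (Q # xs)) \<le> c * log 2 (real n) \<longrightarrow> \<not> lasso k Q xs"
      by (elim exE conjE) (rule that)
    have edges: "edges (clique_hypergraph ({..<n}, G) k) = {A \<in> cliques n k. A \<subseteq> G}"
      by (auto simp: clique_hypergraph_def cliques_def)
    have "ramsey_arrow ({..<n}, G) k r"
      unfolding ramsey_arrow_def edges
    proof
      fix col assume "col \<in> edges ({..<n}, G) \<rightarrow> {..<r}"
      then have "\<forall>e\<in>G. col e < r" by auto
      then show "\<exists>F\<in>{A \<in> cliques n k. A \<subseteq> G}. \<exists>i<r. \<forall>e\<in>F. col e = i"
        using G(2) unfolding clique_colourable_def by blast
    qed
    moreover have "girth_at_least (k choose 2) (clique_hypergraph ({..<n}, G) k) (c * log 2 (real n))"
      unfolding girth_at_least_def edges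
    proof (intro allI impI)
      fix h :: nat and S
      assume h: "2 \<le> h \<and> real h < c * log 2 (real n)" and S: "S \<subseteq> {A \<in> cliques n k. A \<subseteq> G} \<and> card S = h"
      \<comment> \<open>The lasso argument works with vertex sets, the girth with edge sets;
        \<open>inj_on_nsets2\<close> makes the translation preserve cardinality.\<close>
      define F where "F = {W \<in> [{..<n}]\<^bsup>k\<^esup>. [W]\<^bsup>2\<^esup> \<in> S}"
      have SF: "S = (\<lambda>W. [W]\<^bsup>2\<^esup>) ` F" using S by (auto simp: F_def cliques_def)
      have "inj_on (\<lambda>W. [W]\<^bsup>2\<^esup>) F"
        using assms by (intro inj_on_subset[OF inj_on_nsets2[of k "{..<n}"]]) (auto simp: F_def)
      then have cF: "card F = h" using S SF by (simp add: card_image)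
      have fF: "finite F" by (simp add: F_def finite_imp_finite_nsets)
      have "((k choose 2) - 1) * card F + 1 \<le> card (clique_edges F)"
      proof (rule lasso_free_span[OF assms(1) fF])
        show "F \<noteq> {}" using cF h by auto
        show "\<forall>W\<in>F. finite W \<and> card W = k" by (auto simp: F_def nsets_def)
        fix Q xs assume Q: "set (Q # xs) \<subseteq> F" "length (Q # xs) \<le> card F"
        show "\<not> lasso k Q xs"
        proof (rule free[rule_format])
          show "set (Q # xs) \<subseteq> [{..<n}]\<^bsup>k\<^esup>" using Q by (auto simp: F_def)
          have "clique_edges F \<subseteq> G" using S by (auto simp: F_def clique_edges_def)
          then show "clique_edges (set (Q # xs)) \<subseteq> G" using Q by (auto simp: clique_edges_def)
          show "real (length (Q # xs)) \<le> c * log 2 (real n)" using Q(2) cF h by linarith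
        qed
      qed
      then show "((k choose 2) - 1) * h + 1 \<le> card (\<Union>S)"
        using cF by (simp add: SF clique_edges_def)
    qed
    moreover have "graph ({..<n}, G)" using G by (simp add: uniform_hypergraph_def)
    ultimately show "\<exists>H :: nat hypergraph. graph H \<and> card (verts H) = n \<and> ramsey_arrow H k r \<and>
        girth_at_least (k choose 2) (clique_hypergraph H k) (c * log 2 (real n))"
      by (intro exI[of _ "({..<n}, G)"]) auto
  qed
qed

end
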